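(* The groups $\operatorname{PC}^{\bowtie}$ and $\operatorname{PAff}^{\bowtie}$ are simple.
   Context: $X=[0,1[$. $\widehat{\operatorname{PC}^{\bowtie}}$ is the group of bijections $X\to X$ continuous outside a finite subset of $X$; $\widehat{\operatorname{PAff}^{\bowtie}}$ is its subgroup of bijections $f$ for which there is a finite partition of $X$ into intervals $[a,b[$ such that $f$ is affine on each open interval $]a,b[$. ${\mathfrak S}_{\mathrm{fin}}$ is the (normal) subgroup of finitely supported permutations of $X$, and $\operatorname{PC}^{\bowtie}=\widehat{\operatorname{PC}^{\bowtie}}/{\mathfrak S}_{\mathrm{fin}}$, $\operatorname{PAff}^{\bowtie}=\widehat{\operatorname{PAff}^{\bowtie}}/{\mathfrak S}_{\mathrm{fin}}$. *)

theory Defs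
  imports "HOL-Analysis.Analysis" "HOL-Algebra.Coset"
begin

definition Xint :: "real set" where "Xint = {0..<1}"

text \<open>Bijections of X are represented as functions real => real that are
  bijective on X and the identity outside X (so that composition is the group law).\<close>
definition perm_X :: "(real \<Rightarrow> real) \<Rightarrow> bool" where
  "perm_X f \<longleftrightarrow> bij_betw f Xint Xint \<and> (\<forall>x. x \<notin> Xint \<longrightarrow> f x = x)"

definition hatPC :: "(real \<Rightarrow> real) set" where
  "hatPC = {f. perm_X f \<and>
      (\<exists>S. finite S \<and> S \<subseteq> Xint \<and> (\<forall>x \<in> Xint - S. continuous (at x within Xint) f))}"

definition hatPAff :: "(real \<Rightarrow> real) set" where
  "hatPAff = {f. perm_X f \<and>
      (\<exists>(n::nat) (t::nat \<Rightarrow> real). n \<ge> 1 \<and> t 0 = 0 \<and> t n = 1 \<and>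
         (\<forall>i<n. t i < t (Suc i)) \<and>
         (\<forall>i<n. \<exists>a b. \<forall>x \<in> {t i<..<t (Suc i)}. f x = a * x + b))}"

definition Sfin :: "(real \<Rightarrow> real) set" where
  "Sfin = {f. perm_X f \<and> finite {x. f x \<noteq> x}}"

definition perm_group :: "(real \<Rightarrow> real) set \<Rightarrow> (real \<Rightarrow> real) monoid" where
  "perm_group C = \<lparr>carrier = C, mult = (\<lambda>f g. f \<circ> g), one = id\<rparr>"

text \<open>Simple group (possibly infinite): a nontrivial group whose only normal subgroups
  are the trivial subgroup and the whole group.  (The library locale simple_group
  requires order G > 1 and hence finiteness, so it is not used.)\<close>
definition simple_grp :: "('a, 'b) monoid_scheme \<Rightarrow> bool" where
  "simple_grp G \<longleftrightarrow> group G \<and> carrier G \<noteq> {\<one>\<^bsub>G\<^esub>} \<and>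
     (\<forall>H. H \<lhd> G \<longrightarrow> H = {\<one>\<^bsub>G\<^esub>} \<or> H = carrier G)"

definition PC :: "(real \<Rightarrow> real) set monoid" where
  "PC = perm_group hatPC Mod Sfin"

definition PAff :: "(real \<Rightarrow> real) set monoid" where
  "PAff = perm_group hatPAff Mod Sfin"

end

theory Submission
  imports Defs
begin

text \<open>
  Let \<open>N\<close> be a normal subgroup of one of the two groups that properly contains the finitely supported
  permutations; equalities below are modulo these. An element of \<open>N\<close> moves some interval off itself,
  and a double commutator shows that \<open>N\<close> contains the product of the reflections of two disjoint
  intervals. All such products (of total length less than 1) are conjugate, so the reflections of any
  two small intervals agree modulo \<open>N\<close>. For concentric intervals \<open>K' \<subseteq> K\<close> the product of the
  reflections of \<open>K\<close> and \<open>K'\<close> exchanges the two components of \<open>K - K'\<close>, hence is itself conjugate to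
  a reflection; so \<open>N\<close> contains all reflections. A piecewise affine homeomorphism \<open>h\<close> of \<open>]0, m[\<close>
  with two pieces is, up to reflections, the product of two copies of \<open>h\<close> on the two halves of the
  interval, and each copy is conjugate to \<open>h\<close> under \<open>N\<close>; thus \<open>h = h\<^sup>2\<close> modulo \<open>N\<close>, that is,
  \<open>h \<in> N\<close>. Multiplying an arbitrary \<open>f\<close> by such elements makes it preserve its pieces, one after the
  other and with increasing orientation. In the affine case nothing remains. In the continuous case an
  increasing homeomorphism \<open>w\<close> of a proper subinterval remains; it is conjugate to one of
  \<open>]1/4, 1/2[\<close>, and then \<open>w = [W, t]\<close> where \<open>t \<in> N\<close> is \<open>x \<mapsto> x / 2\<close> near 0 and \<open>W\<close> is
  the product of the conjugates of \<open>w\<close> by all powers of \<open>t\<close>.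
\<close>

unbundle no m_inv_syntax

subsection \<open>Permutations of the interval\<close>

lemma perm_X_bij: assumes "perm_X f" shows "bij f"
proof -
  have 1: "bij_betw f Xint Xint" and 2: "bij_betw f (- Xint) (- Xint)"
    using assms by (auto simp: perm_X_def bij_betw_def inj_on_def)
  show ?thesis using bij_betw_combine[OF 1 2] by simp
qed

lemma perm_X_iff: "perm_X f \<longleftrightarrow> bij f \<and> (\<forall>x. x \<notin> Xint \<longrightarrow> f x = x)"
proof (intro iffI conjI)
  assume r: "bij f \<and> (\<forall>x. x \<notin> Xint \<longrightarrow> f x = x)"
  then have inj: "inj f" and surj: "surj f" by (auto simp: bij_def)
  have "f ` Xint = Xint"
  proof (intro equalityI subsetI)
    fix y assume "y \<in> f ` Xint"
    then obtain x where x: "x \<in> Xint" "y = f x" by blast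
    show "y \<in> Xint"
    proof (rule ccontr)
      assume "y \<notin> Xint"
      then have "f y = f x" using r x by simp
      then show False using inj x \<open>y \<notin> Xint\<close> by (simp add: inj_eq)
    qed
  next
    fix y assume y: "y \<in> Xint"
    obtain x where "f x = y" using surj by (metis surjD)
    then show "y \<in> f ` Xint" using r y by (cases "x \<in> Xint") auto
  qed
  then have "bij_betw f Xint Xint" using inj by (metis bij_betw_def inj_on_subset subset_UNIV)
  then show "perm_X f" using r by (simp add: perm_X_def)
qed (auto simp: perm_X_bij perm_X_def)

lemma perm_X_comp: "perm_X f \<Longrightarrow> perm_X g \<Longrightarrow> perm_X (g \<circ> f)"
  by (auto simp: perm_X_iff bij_comp)

lemma perm_X_inv: "perm_X f \<Longrightarrow> perm_X (inv f)"
  unfolding perm_X_iff by (metis bij_imp_bij_inv bij_inv_eq_iff)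

lemma perm_X_range: "perm_X f \<Longrightarrow> x \<in> Xint \<Longrightarrow> f x \<in> Xint"
  by (auto simp: perm_X_def bij_betw_def)

lemma perm_X_inv_f: "perm_X f \<Longrightarrow> inv f (f x) = x"
  by (simp add: perm_X_bij bij_is_inj)

lemma perm_X_f_inv: "perm_X f \<Longrightarrow> f (inv f x) = x"
  by (simp add: perm_X_bij bij_is_surj surj_f_inv_f)

lemma perm_X_involution:
  assumes "\<And>x. f (f x) = x" "\<And>x. x \<notin> Xint \<Longrightarrow> f x = x"
  shows "perm_X f"
  using assms by (auto simp: perm_X_iff intro: involuntory_imp_bij)

subsection \<open>Reflections and two-piece homeomorphisms\<close>

text \<open>Acting on the open interval and fixing the end points makes this an involution of the
  whole line for all \<open>a\<close> and \<open>b\<close>. Flipping \<open>[a, b[\<close> instead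
  would send \<open>a\<close> to \<open>b\<close>, possibly out of X.\<close>

definition refl_on_ivl :: "real \<Rightarrow> real \<Rightarrow> real \<Rightarrow> real" where
  "refl_on_ivl a b x = (if a < x \<and> x < b then a + b - x else x)"

text \<open>The homeomorphism of \<open>[0, m]\<close> with one break point, \<open>p\<close>, which
  goes to \<open>q\<close>. The slopes are \<open>q / p\<close> and
  \<open>(m - q) / (m - p)\<close>; the second branch scales the distance to
  \<open>m\<close>.\<close>

definition two_piece :: "real \<Rightarrow> real \<Rightarrow> real \<Rightarrow> real \<Rightarrow> real" where
  "two_piece m p q x = (if x \<le> 0 \<or> m \<le> x then x else if x \<le> p then q / p * x
     else m - (m - x) * ((m - q) / (m - p)))"

lemma refl_involution [simp]: "refl_on_ivl a b (refl_on_ivl a b x) = x"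
  by (auto simp: refl_on_ivl_def)

lemma refl_bij [simp]: "bij (refl_on_ivl a b)"
  by (rule involuntory_imp_bij) simp

lemma inv_refl [simp]: "inv (refl_on_ivl a b) = refl_on_ivl a b"
  by (rule inv_equality) simp_all

lemma refl_perm: "0 \<le> a \<Longrightarrow> b \<le> 1 \<Longrightarrow> perm_X (refl_on_ivl a b)"
  by (rule perm_X_involution) (auto simp: refl_on_ivl_def Xint_def)

lemma two_piece_left: "0 < p \<Longrightarrow> p < m \<Longrightarrow> 0 < x \<Longrightarrow> x \<le> p \<Longrightarrow> two_piece m p q x = q / p * x"
  by (simp add: two_piece_def)

lemma two_piece_right:
  "0 < p \<Longrightarrow> p < m \<Longrightarrow> p < x \<Longrightarrow> x < m \<Longrightarrow>
    two_piece m p q x = m - (m - x) * ((m - q) / (m - p))"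
  by (simp add: two_piece_def)

lemma two_piece_outside: "x \<le> 0 \<or> m \<le> x \<Longrightarrow> two_piece m p q x = x"
  by (auto simp: two_piece_def)

lemma two_piece_inverse:
  assumes "0 < p" "p < m" "0 < q" "q < m"
  shows "two_piece m q p (two_piece m p q x) = x"
proof -
  consider "x \<le> 0 \<or> m \<le> x" | "0 < x" "x \<le> p" | "p < x" "x < m" by linarith
  then show ?thesis
  proof cases
    case 2
    have "0 < q / p * x" "q / p * x \<le> q" using assms 2 by (auto simp: field_simps)
    then show ?thesis using assms 2 by (simp add: two_piece_left)
  next
    case 3
    let ?s = "(m - q) / (m - p)"
    have s: "?s > 0" using assms by simp
    have "(m - x) * ?s < (m - p) * ?s" using s 3 by (intro mult_strict_right_mono) auto
    moreover have "(m - p) * ?s = m - q" using assms by simp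
    moreover have "(m - x) * ?s > 0" by (rule mult_pos_pos) (use s 3 in auto)
    ultimately have "q < m - (m - x) * ?s" "m - (m - x) * ?s < m" by linarith+
    then show ?thesis using assms 3 by (simp add: two_piece_right)
  qed (simp add: two_piece_outside)
qed

lemma two_piece_bij:
  assumes "0 < p" "p < m" "0 < q" "q < m"
  shows "bij (two_piece m p q)"
  by (rule o_bij[of "two_piece m q p"]) (use assms in \<open>auto simp: two_piece_inverse\<close>)

lemma inv_two_piece:
  assumes "0 < p" "p < m" "0 < q" "q < m"
  shows "inv (two_piece m p q) = two_piece m q p"
  by (rule inv_equality) (use assms in \<open>auto simp: two_piece_inverse\<close>)

lemma two_piece_perm:
  assumes "0 < p" "p < m" "0 < q" "q < m" "m \<le> 1"
  shows "perm_X (two_piece m p q)"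
  using two_piece_bij[OF assms(1-4)] assms(5) by (auto simp: perm_X_iff two_piece_def Xint_def)

lemma two_piece_half:
  "two_piece (m / 2) (p / 2) (q / 2) (x / 2) = two_piece m p q x / 2"
proof -
  have "(m / 2 - q / 2) / (m / 2 - p / 2) = (m - q) / (m - p)"
    by (metis diff_divide_distrib divide_divide_eq_left' mult.commute mult_divide_mult_cancel_left
        nonzero_mult_div_cancel_left times_divide_eq_right zero_neq_numeral)
  moreover have "(m / 2 - x / 2) * s = ((m - x) * s) / 2" for s by (simp add: field_simps)
  ultimately show ?thesis unfolding two_piece_def by (simp add: diff_divide_distrib)
qed

text \<open>The values of \<open>k\<close> off \<open>]a, b[\<close> are arbitrary: by injectivity
  no outside point lands in the image interval, so both sides are the identity off that
  interval.\<close>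

lemma conj_refl_incr:
  assumes "bij k" and k: "\<And>x. a < x \<Longrightarrow> x < b \<Longrightarrow> k x = \<alpha> * x + \<beta>" and \<alpha>: "\<alpha> > 0"
  shows "k \<circ> refl_on_ivl a b \<circ> inv k = refl_on_ivl (\<alpha> * a + \<beta>) (\<alpha> * b + \<beta>)"
proof
  fix y
  obtain x where y: "y = k x" using assms(1) by (metis bij_pointE)
  have inv: "inv k y = x" using y assms(1) by (simp add: bij_is_inj)
  show "(k \<circ> refl_on_ivl a b \<circ> inv k) y = refl_on_ivl (\<alpha> * a + \<beta>) (\<alpha> * b + \<beta>) y"
  proof (cases "a < x \<and> x < b")
    case True
    then have "\<alpha> * a < \<alpha> * x" "\<alpha> * x < \<alpha> * b" using \<alpha> by simp_all
    moreover have "k (a + b - x) = \<alpha> * (a + b - x) + \<beta>" using True k by simp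
    ultimately show ?thesis
      using True inv y k[of x] by (simp add: refl_on_ivl_def algebra_simps)
  next
    case False
    have "\<not> (\<alpha> * a + \<beta> < y \<and> y < \<alpha> * b + \<beta>)"
    proof
      assume H: "\<alpha> * a + \<beta> < y \<and> y < \<alpha> * b + \<beta>"
      define z where "z = (y - \<beta>) / \<alpha>"
      have z: "y = \<alpha> * z + \<beta>" using \<alpha> by (simp add: z_def)
      have ab: "a < z" "z < b" using H \<alpha> unfolding z by simp_all
      then have "k z = k x" using k y z by simp
      then have "z = x" using assms(1) by (simp add: bij_is_inj inj_eq)
      then show False using False ab by simp
    qed
    then have "refl_on_ivl (\<alpha> * a + \<beta>) (\<alpha> * b + \<beta>) y = y" by (auto simp: refl_on_ivl_def)
    moreover have "refl_on_ivl a b x = x" using False by (auto simp: refl_on_ivl_def)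
    ultimately show ?thesis using inv y by simp
  qed
qed

text \<open>Slope -1 suffices here, because the orientation-reversing conjugators below are single
  reflections.\<close>

lemma conj_refl_decr:
  assumes "bij k" and k: "\<And>x. a < x \<Longrightarrow> x < b \<Longrightarrow> k x = \<beta> - x"
  shows "k \<circ> refl_on_ivl a b \<circ> inv k = refl_on_ivl (\<beta> - b) (\<beta> - a)"
proof
  fix y
  obtain x where y: "y = k x" using assms(1) by (metis bij_pointE)
  have inv: "inv k y = x" using y assms(1) by (simp add: bij_is_inj)
  show "(k \<circ> refl_on_ivl a b \<circ> inv k) y = refl_on_ivl (\<beta> - b) (\<beta> - a) y"
  proof (cases "a < x \<and> x < b")
    case True
    then show ?thesis using inv y k[of x] k[of "a + b - x"] by (simp add: refl_on_ivl_def)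
  next
    case False
    have "\<not> (\<beta> - b < y \<and> y < \<beta> - a)"
    proof
      assume H: "\<beta> - b < y \<and> y < \<beta> - a"
      then have "k (\<beta> - y) = k x" using k[of "\<beta> - y"] y by simp
      then have "\<beta> - y = x" using assms(1) by (simp add: bij_is_inj inj_eq)
      then show False using False H by auto
    qed
    then have "refl_on_ivl (\<beta> - b) (\<beta> - a) y = y" by (auto simp: refl_on_ivl_def)
    moreover have "refl_on_ivl a b x = x" using False by (auto simp: refl_on_ivl_def)
    ultimately show ?thesis using inv y by simp
  qed
qed

text \<open>A two-piece map is, away from finitely many points, a product of reflections and of two copies
  of the half-scale two-piece map; modulo reflections this expresses it as a square.\<close>

lemma two_piece_doubling:
  assumes pq: "0 < p" "p < m" "0 < q" "q < m" and x: "x \<notin> {0, p / 2, p, m}"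
  defines "h \<equiv> two_piece (m / 2) (p / 2) (q / 2)" and "r \<equiv> refl_on_ivl 0 m"
  shows "refl_on_ivl (q / 2) m (h (r (h (r (refl_on_ivl (p / 2) m x))))) = two_piece m p q x"
proof -
  let ?s = "(m - q) / (m - p)"
  have s: "?s > 0" using pq by simp
  have s': "(m / 2 - q / 2) / (m / 2 - p / 2) = ?s"
    by (metis diff_divide_distrib divide_divide_eq_left' mult.commute mult_divide_mult_cancel_left
        nonzero_mult_div_cancel_left times_divide_eq_right zero_neq_numeral)
  have hl: "h z = q / p * z" if "0 < z" "z \<le> p / 2" for z
    using that pq by (simp add: h_def two_piece_left)
  have hl_range: "0 < q / p * z" "q / p * z < q / 2" if "0 < z" "z < p / 2" for z
    using that pq by (auto simp: field_simps)
  have hr: "h z = m / 2 - (m / 2 - z) * ?s" if "p / 2 < z" "z < m / 2" for z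
    using that pq unfolding h_def by (subst two_piece_right) (auto simp: s')
  have hr_range: "q / 2 < m / 2 - (m / 2 - z) * ?s" "m / 2 - (m / 2 - z) * ?s < m / 2"
    if "p / 2 < z" "z < m / 2" for z
  proof -
    have "(m / 2 - z) * ?s < (m / 2 - p / 2) * ?s"
      using s that by (intro mult_strict_right_mono) auto
    moreover have "(m / 2 - p / 2) * ?s = m / 2 - q / 2" using pq by (simp add: field_simps)
    moreover have "(m / 2 - z) * ?s > 0" by (rule mult_pos_pos) (use s that in auto)
    ultimately show "q / 2 < m / 2 - (m / 2 - z) * ?s" "m / 2 - (m / 2 - z) * ?s < m / 2"
      by linarith+
  qed
  have ho: "h z = z" if "m / 2 \<le> z \<or> z \<le> 0" for z using that by (auto simp: h_def two_piece_outside)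
  have key: "(m / 2 - p / 2) * ?s = m / 2 - q / 2" using pq by (simp add: field_simps)
  have r: "r z = m - z" if "0 < z" "z < m" for z using that by (simp add: r_def refl_on_ivl_def)
  have rq: "refl_on_ivl (q / 2) m z = q / 2 + m - z" if "q / 2 < z" "z < m" for z
    using that by (simp add: refl_on_ivl_def)
  have rp: "r (refl_on_ivl (p / 2) m x) = x - p / 2" if "p / 2 < x" "x < m"
    using that pq r[of "p / 2 + m - x"] by (simp add: refl_on_ivl_def)
  have xs: "x \<noteq> 0" "x \<noteq> p / 2" "x \<noteq> p" "x \<noteq> m" using x by auto
  \<comment> \<open>The first two reflections bring \<open>]p/2, (p+m)/2[\<close> to the left half
    by a translation, and the inner \<open>h\<close> acts there with its two slopes, meeting at the
    image of \<open>p\<close>. The next \<open>r\<close> brings the other points to the left half: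
    \<open>]0, p/2[\<close> returns to itself and \<open>](p+m)/2, m[\<close> goes to
    \<open>]p/2, m/2[\<close> reversed, where the outer \<open>h\<close> acts. The last reflection
    reassembles the parts. The point \<open>(p+m)/2\<close> passes through the midpoint
    \<open>m/2\<close>, fixed by \<open>h\<close> and \<open>r\<close>.\<close>
  consider "x < 0 \<or> m < x" | "0 < x" "x < p / 2" | "p / 2 < x" "x < p"
    | "p < x" "x < m" "x - p / 2 < m / 2" | "p < x" "x < m" "m / 2 < x - p / 2"
    | "p < x" "x < m" "x - p / 2 = m / 2"
    using xs by linarith
  then show ?thesis
  proof cases
    case 1
    then show ?thesis using pq ho[of x] by (auto simp: refl_on_ivl_def r_def two_piece_def)
  next
    case 2
    define w where "w = q / p * x"
    have w: "0 < w" "w < q / 2" using hl_range[OF 2] by (simp_all add: w_def)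
    have 1: "refl_on_ivl (p / 2) m x = x" "refl_on_ivl (q / 2) m w = w"
      using 2 w by (simp_all add: refl_on_ivl_def)
    have 2: "r x = m - x" "r (m - x) = x" "h (m - x) = m - x" "h x = w" "two_piece m p q x = w"
      using 2 pq by (auto simp: r ho hl w_def two_piece_left)
    show ?thesis by (simp only: 1 2)
  next
    case 3
    define w where "w = q / p * (x - p / 2)"
    have z: "0 < x - p / 2" "x - p / 2 < p / 2" using 3 by auto
    have w: "0 < w" "w < q / 2" using hl_range[OF z] by (simp_all add: w_def)
    have 1: "r (refl_on_ivl (p / 2) m x) = x - p / 2" using 3 pq by (intro rp) auto
    have 2: "h (x - p / 2) = w" using hl z by (simp add: w_def)
    have 4: "r w = m - w" "h (m - w) = m - w" "refl_on_ivl (q / 2) m (m - w) = q / 2 + w"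
      using w pq by (simp_all add: r ho rq)
    have 5: "q / 2 + w = two_piece m p q x"
      using 3 pq by (simp add: two_piece_left w_def field_simps)
    show ?thesis by (simp only: 1 2 4 5)
  next
    case 4
    define w where "w = m / 2 - (m / 2 - (x - p / 2)) * ?s"
    have z: "p / 2 < x - p / 2" "x - p / 2 < m / 2" using 4 by auto
    have w: "q / 2 < w" "w < m / 2" using hr_range[OF z] by (simp_all add: w_def)
    have 1: "r (refl_on_ivl (p / 2) m x) = x - p / 2" using 4 pq by (intro rp) auto
    have 2: "h (x - p / 2) = w" unfolding w_def by (rule hr[OF z])
    have 3: "r w = m - w" "h (m - w) = m - w" "refl_on_ivl (q / 2) m (m - w) = q / 2 + w"
      using w pq by (simp_all add: r ho rq)
    have "(m - x) * ?s = (m / 2 - (x - p / 2)) * ?s + (m / 2 - p / 2) * ?s"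
      by (simp only: distrib_right[symmetric]) simp
    then have "q / 2 + w = m - (m - x) * ?s" unfolding w_def key by linarith
    then have 5: "q / 2 + w = two_piece m p q x"
      using 4 pq two_piece_right[of p m x q] by linarith
    show ?thesis by (simp only: 1 2 3 5)
  next
    case 5
    define w where "w = m / 2 - (m / 2 - (m - (x - p / 2))) * ?s"
    have z: "p / 2 < m - (x - p / 2)" "m - (x - p / 2) < m / 2" using 5 by auto
    have w: "q / 2 < w" "w < m / 2" using hr_range[OF z] by (simp_all add: w_def)
    have 1: "r (refl_on_ivl (p / 2) m x) = x - p / 2" using 5 pq by (intro rp) auto
    have 2: "h (x - p / 2) = x - p / 2" "r (x - p / 2) = m - (x - p / 2)"
      using 5 pq by (auto simp: ho r)
    have 3: "h (m - (x - p / 2)) = w" unfolding w_def by (rule hr[OF z])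
    have 4: "refl_on_ivl (q / 2) m w = q / 2 + m - w" using w pq by (intro rq) auto
    have "(m / 2 - (m - (x - p / 2))) * ?s = (m / 2 - p / 2) * ?s - (m - x) * ?s"
      by (simp only: left_diff_distrib[symmetric]) simp
    then have "q / 2 + m - w = m - (m - x) * ?s" unfolding w_def key by linarith
    then have 5: "q / 2 + m - w = two_piece m p q x"
      using 5 pq two_piece_right[of p m x q] by linarith
    show ?thesis by (simp only: 1 2 3 4 5)
  next
    case 6
    have 1: "r (refl_on_ivl (p / 2) m x) = m / 2" using 6 pq rp by simp
    have 2: "h (m / 2) = m / 2" "r (m / 2) = m / 2" "refl_on_ivl (q / 2) m (m / 2) = q / 2 + m / 2"
      using pq by (simp_all add: ho r rq)
    have "m - x = m / 2 - p / 2" using 6 by simp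
    then have "q / 2 + m / 2 = m - (m - x) * ?s" using key by simp
    then have 3: "q / 2 + m / 2 = two_piece m p q x"
      using 6 pq two_piece_right[of p m x q] by linarith
    show ?thesis by (simp only: 1 2 3)
  qed
qed

text \<open>The slope 3/4 near 0 is followed, after a flip, by the slope 2/3 of the inverse map near
  the other end, and 3/4 times 2/3 is 1/2. The image \<open>3 * m / 4\<close> of \<open>m\<close> is
  the midpoint of the flipped interval, so the flip carries the image of \<open>]0, m[\<close>
  exactly onto the second piece of the inverse. The word is the product of \<open>r\<close> and a
  conjugate of \<open>r\<close>, hence lies in every normal subgroup containing
  \<open>r\<close>.\<close>

lemma halving_word:
  assumes "0 < x" "x < m"
  defines "r \<equiv> refl_on_ivl 0 (3 * m / 2)"
  shows "r (two_piece (3 * m / 2) (3 * m / 4) m (r (two_piece (3 * m / 2) m (3 * m / 4) x))) = x / 2"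
proof -
  have "two_piece (3 * m / 2) m (3 * m / 4) x = 3 * x / 4"
    using assms by (simp add: two_piece_left)
  moreover have "r (3 * x / 4) = 3 * m / 2 - 3 * x / 4"
    using assms by (simp add: refl_on_ivl_def)
  moreover have "two_piece (3 * m / 2) (3 * m / 4) m (3 * m / 2 - 3 * x / 4) = 3 * m / 2 - x / 2"
    using assms by (subst two_piece_right) (auto simp: field_simps)
  moreover have "r (3 * m / 2 - x / 2) = x / 2" using assms by (simp add: refl_on_ivl_def)
  ultimately show ?thesis by (simp only:)
qed

subsection \<open>Groups of piecewise regular permutations\<close>

text \<open>Treats both groups at once: \<open>P f x\<close> will be "affine near x" or "continuous
  at x". The axiom \<open>inverse\<close> asks for \<open>P f\<close> in a neighbourhood, since
  continuity of a bijection at one point does not give continuity of the inverse at its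
  image.\<close>

locale local_regularity =
  fixes P :: "(real \<Rightarrow> real) \<Rightarrow> real \<Rightarrow> bool"
  assumes affine: "eventually (\<lambda>y. f y = \<alpha> * y + \<beta>) (nhds x) \<Longrightarrow> P f x"
    and comp: "P f x \<Longrightarrow> P g (f x) \<Longrightarrow> P (g \<circ> f) x"
    and inverse: "bij f \<Longrightarrow> eventually (P f) (nhds x) \<Longrightarrow> P (inv f) (f x)"
    and cont: "P f x \<Longrightarrow> isCont f x"
    and cong: "eventually (\<lambda>y. f y = g y) (nhds x) \<Longrightarrow> P f x \<Longrightarrow> P g x"
begin

text \<open>\<open>P\<close> is a two-sided condition on the line, so it is tested only in the
  interior of X; the end point 0 would be one more permitted exception.\<close>

definition G :: "(real \<Rightarrow> real) set" where
  "G = {f. perm_X f \<and> finite {x \<in> {0<..<1}. \<not> P f x}}"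

lemma G_perm: "f \<in> G \<Longrightarrow> perm_X f"
  and G_bij: "f \<in> G \<Longrightarrow> bij f"
  by (auto simp: G_def perm_X_bij)

lemma G_I:
  assumes "perm_X f" "finite T" "\<And>x. 0 < x \<Longrightarrow> x < 1 \<Longrightarrow> x \<notin> T \<Longrightarrow> P f x"
  shows "f \<in> G"
  using assms by (auto simp: G_def intro: finite_subset[of _ T])

lemma G_D: assumes "f \<in> G" shows "finite {x \<in> {0<..<1}. \<not> P f x}"
  using assms by (simp add: G_def)

lemma eventually_avoid_finite:
  fixes x :: real
  assumes "finite T" "x \<notin> T" shows "eventually (\<lambda>y. y \<notin> T) (nhds x)"
  using eventually_nhds_in_open[of "- T" x] assms by (simp add: finite_imp_closed open_Compl)

lemma G_comp: assumes f: "f \<in> G" and g: "g \<in> G" shows "g \<circ> f \<in> G"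
proof -
  define B where "B h = {x \<in> {0<..<1}. \<not> P h x}" for h
  show ?thesis
  \<comment> \<open>The preimage of 0 is excluded too, because membership of \<open>g\<close> in
    \<open>G\<close> says nothing about \<open>P g\<close> at 0.\<close>
  proof (rule G_I[where T = "B f \<union> f -` (insert 0 (B g))"])
    show "perm_X (g \<circ> f)" using f g by (simp add: G_perm perm_X_comp)
    show "finite (B f \<union> f -` insert 0 (B g))"
      using G_D[OF f] G_D[OF g] G_bij[OF f] by (simp add: B_def finite_vimageI bij_is_inj)
    fix x :: real assume x: "0 < x" "x < 1" "x \<notin> B f \<union> f -` insert 0 (B g)"
    then have "f x \<in> Xint" using perm_X_range[OF G_perm[OF f], of x] by (simp add: Xint_def)
    then have "P g (f x)" "P f x" using x by (auto simp: B_def Xint_def)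
    then show "P (g \<circ> f) x" by (rule comp[rotated])
  qed
qed

lemma G_inv: assumes f: "f \<in> G" shows "inv f \<in> G"
proof -
  define B where "B = {x \<in> {0<..<1}. \<not> P f x}"
  have fin: "finite B" using G_D[OF f] by (simp add: B_def)
  show ?thesis
  proof (rule G_I[where T = "f ` insert 0 B"])
    show "perm_X (inv f)" using f by (simp add: G_perm perm_X_inv)
    show "finite (f ` insert 0 B)" using fin by simp
    fix y :: real assume y: "0 < y" "y < 1" "y \<notin> f ` insert 0 B"
    define x where "x = inv f y"
    have yx: "y = f x" using f by (simp add: x_def perm_X_f_inv G_perm)
    have "x \<in> Xint" using perm_X_range[OF perm_X_inv[OF G_perm[OF f]], of y] y
      by (simp add: Xint_def x_def)
    moreover have "x \<noteq> 0" "x \<notin> B" using y yx by auto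
    ultimately have x: "0 < x" "x < 1" "x \<notin> B" by (auto simp: Xint_def)
    have "eventually (\<lambda>z. z \<notin> B) (nhds x)" by (rule eventually_avoid_finite[OF fin x(3)])
    moreover have "eventually (\<lambda>z. z \<in> {0<..<1}) (nhds x)"
      using x by (intro eventually_nhds_in_open) auto
    ultimately have "eventually (P f) (nhds x)" by eventually_elim (auto simp: B_def)
    then show "P (inv f) y" using inverse[OF G_bij[OF f]] by (simp add: yx)
  qed
qed

lemma P_id_near: assumes "eventually (\<lambda>y. f y = y) (nhds x)" shows "P f x"
  by (rule affine[of _ 1 0]) (use assms in simp)

lemma Sfin_subset_G: "Sfin \<subseteq> G"
proof
  fix f assume f: "f \<in> Sfin"
  show "f \<in> G"
  proof (rule G_I[where T = "{x. f x \<noteq> x}"])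
    fix x assume "x \<notin> {x. f x \<noteq> x}"
    then have "eventually (\<lambda>y. y \<notin> {x. f x \<noteq> x}) (nhds x)"
      using f by (intro eventually_avoid_finite) (auto simp: Sfin_def)
    then show "P f x" by (intro P_id_near) (auto elim: eventually_mono)
  qed (use f in \<open>auto simp: Sfin_def\<close>)
qed

lemma P_refl: assumes "x \<noteq> a" "x \<noteq> b" shows "P (refl_on_ivl a b) x"
proof -
  consider "x < a" | "b < x" | "a < x" "x < b" using assms by linarith
  then show ?thesis
  proof cases
    case 1
    then have "eventually (\<lambda>y. y \<in> {..<a}) (nhds x)" by (intro eventually_nhds_in_open) auto
    then show ?thesis by (intro P_id_near) (auto elim!: eventually_mono simp: refl_on_ivl_def)
  next
    case 2
    then have "eventually (\<lambda>y. y \<in> {b<..}) (nhds x)" by (intro eventually_nhds_in_open) auto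
    then show ?thesis by (intro P_id_near) (auto elim!: eventually_mono simp: refl_on_ivl_def)
  next
    case 3
    then have "eventually (\<lambda>y. y \<in> {a<..<b}) (nhds x)" by (intro eventually_nhds_in_open) auto
    then show ?thesis
      by (intro affine[of _ "-1" "a + b"]) (auto elim!: eventually_mono simp: refl_on_ivl_def)
  qed
qed

lemma P_two_piece: assumes "x \<noteq> 0" "x \<noteq> p" "x \<noteq> m" "0 < p" "p < m" shows "P (two_piece m p q) x"
proof -
  consider "x < 0" | "m < x" | "0 < x" "x < p" | "p < x" "x < m" using assms by linarith
  then show ?thesis
  proof cases
    case 1
    then have "eventually (\<lambda>y. y \<in> {..<0}) (nhds x)" by (intro eventually_nhds_in_open) auto
    then show ?thesis by (intro P_id_near) (auto elim!: eventually_mono simp: two_piece_def)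
  next
    case 2
    then have "eventually (\<lambda>y. y \<in> {m<..}) (nhds x)" by (intro eventually_nhds_in_open) auto
    then show ?thesis by (intro P_id_near) (auto elim!: eventually_mono simp: two_piece_def)
  next
    case 3
    then have "eventually (\<lambda>y. y \<in> {0<..<p}) (nhds x)" by (intro eventually_nhds_in_open) auto
    then show ?thesis
      by (intro affine[of _ "q / p" 0])
        (use assms in \<open>auto elim!: eventually_mono simp: two_piece_left\<close>)
  next
    case 4
    let ?s = "(m - q) / (m - p)"
    have "eventually (\<lambda>y. y \<in> {p<..<m}) (nhds x)"
      using 4 by (intro eventually_nhds_in_open) auto
    moreover have "two_piece m p q y = ?s * y + (m - m * ?s)" if "y \<in> {p<..<m}" for y
    proof -
      have "two_piece m p q y = m - (m - y) * ?s" using that assms by (intro two_piece_right) auto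
      then show ?thesis by algebra
    qed
    ultimately show ?thesis
      by (intro affine[of _ ?s "m - m * ?s"]) (auto elim!: eventually_mono)
  qed
qed

lemma refl_G: "0 \<le> a \<Longrightarrow> b \<le> 1 \<Longrightarrow> refl_on_ivl a b \<in> G"
  by (rule G_I[where T = "{a, b}"]) (auto simp: refl_perm intro: P_refl)

lemma two_piece_G: "0 < p \<Longrightarrow> p < m \<Longrightarrow> 0 < q \<Longrightarrow> q < m \<Longrightarrow> m \<le> 1 \<Longrightarrow> two_piece m p q \<in> G"
  by (rule G_I[where T = "{0, p, m}"]) (auto simp: two_piece_perm intro: P_two_piece)

end

section \<open>The preimage \<open>N\<close> in \<open>G\<close> of a nontrivial normal subgroup of
  the quotient\<close>

locale noncentral_normal = local_regularity +
  fixes N :: "(real \<Rightarrow> real) set"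
  assumes N_sub: "N \<subseteq> G" and Sfin_sub: "Sfin \<subseteq> N"
    and N_comp: "f \<in> N \<Longrightarrow> g \<in> N \<Longrightarrow> f \<circ> g \<in> N"
    and N_inv: "f \<in> N \<Longrightarrow> inv f \<in> N"
    and N_conj: "f \<in> N \<Longrightarrow> k \<in> G \<Longrightarrow> k \<circ> f \<circ> inv k \<in> N"
    and N_nontrivial: "N \<noteq> Sfin"
begin

text \<open>The quotient \<open>g \<circ> inv f\<close> is finitely supported. Hence an identity
  between words may be checked off finitely many points.\<close>

lemma N_congruent:
  assumes f: "f \<in> N" and g: "perm_X g" and fin: "finite {x. f x \<noteq> g x}"
  shows "g \<in> N"
proof -
  have pf: "perm_X f" using f N_sub G_perm by blast
  have "finite {x. (g \<circ> inv f) x \<noteq> x}"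
  proof (rule finite_subset)
    show "{x. (g \<circ> inv f) x \<noteq> x} \<subseteq> f ` {x. f x \<noteq> g x}"
    proof
      fix x assume "x \<in> {x. (g \<circ> inv f) x \<noteq> x}"
      then show "x \<in> f ` {x. f x \<noteq> g x}"
        using perm_X_f_inv[OF pf, of x] by (intro image_eqI[of _ _ "inv f x"]) auto
    qed
  qed (use fin in simp)
  then have "g \<circ> inv f \<in> Sfin" using g pf by (simp add: Sfin_def perm_X_comp perm_X_inv)
  then have "(g \<circ> inv f) \<circ> f \<in> N" using Sfin_sub f N_comp by blast
  moreover have "(g \<circ> inv f) \<circ> f = g" using perm_X_inv_f[OF pf] by (auto simp: fun_eq_iff)
  ultimately show ?thesis by simp
qed

lemma N_unconj:
  assumes "k \<circ> f \<circ> inv k \<in> N" "k \<in> G"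
  shows "f \<in> N"
proof -
  have "inv k \<circ> (k \<circ> f \<circ> inv k) \<circ> inv (inv k) \<in> N" by (rule N_conj) (use assms G_inv in auto)
  moreover have "inv k \<circ> (k \<circ> f \<circ> inv k) \<circ> inv (inv k) = f"
    using G_bij[OF assms(2)] by (auto simp: fun_eq_iff inv_inv_eq bij_is_inj)
  ultimately show ?thesis by (simp only:)
qed

lemma N_conj_iff: "k \<in> G \<Longrightarrow> k \<circ> f \<circ> inv k \<in> N \<longleftrightarrow> f \<in> N"
  using N_conj N_unconj by blast

text \<open>An element outside \<open>Sfin\<close> moves infinitely many points, hence some point of
  \<open>]0, 1[\<close> at which \<open>P\<close>, and so continuity, holds.\<close>

lemma exists_displaced_interval:
  obtains f x e where "f \<in> N" "0 < e" "0 \<le> x - e" "x + e \<le> 1"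
    "\<And>y z. \<bar>y - x\<bar> < e \<Longrightarrow> \<bar>z - x\<bar> < e \<Longrightarrow> f y \<noteq> z"
proof -
  obtain f where f: "f \<in> N" "f \<notin> Sfin" using N_nontrivial Sfin_sub by blast
  have fG: "f \<in> G" using f N_sub by blast
  let ?B = "{x \<in> {0<..<1}. \<not> P f x}"
  have "infinite {x. f x \<noteq> x}" using f G_perm[OF fG] by (simp add: Sfin_def)
  moreover have "finite (insert 0 ?B)" using G_D[OF fG] by simp
  ultimately have "infinite ({x. f x \<noteq> x} - insert 0 ?B)" by (rule Diff_infinite_finite[rotated])
  then have "{x. f x \<noteq> x} - insert 0 ?B \<noteq> {}" by (metis finite.emptyI)
  then obtain x where x: "f x \<noteq> x" "x \<noteq> 0" "x \<notin> ?B" by blast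
  have "x \<in> Xint" using x(1) G_perm[OF fG] by (auto simp: perm_X_iff)
  then have x01: "0 < x" "x < 1" and "P f x" using x by (auto simp: Xint_def)
  then have c: "isCont f x" using cont by blast
  \<comment> \<open>With half the displacement as radius, the balls around \<open>x\<close> and
    \<open>f x\<close> are disjoint.\<close>
  define d where "d = \<bar>f x - x\<bar> / 2"
  have d: "d > 0" using x by (simp add: d_def)
  obtain \<delta> where \<delta>: "\<delta> > 0" "\<And>y. \<bar>y - x\<bar> < \<delta> \<Longrightarrow> \<bar>f y - f x\<bar> < d"
    using c d unfolding continuous_at_eps_delta by (metis dist_real_def)
  define e where "e = min (min \<delta> d) (min x (1 - x))"
  show thesis
  proof (rule that[of f e x])
    show "0 < e" "0 \<le> x - e" "x + e \<le> 1" using \<delta> d x01 by (auto simp: e_def)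
    fix y z assume yz: "\<bar>y - x\<bar> < e" "\<bar>z - x\<bar> < e"
    then have "\<bar>f y - f x\<bar> < d" "\<bar>z - x\<bar> < d" using \<delta>(2)[of y] by (auto simp: e_def)
    then show "f y \<noteq> z" unfolding d_def by (auto simp: abs_if split: if_splits)
  qed (use f in auto)
qed

text \<open>If \<open>f\<close> moves an interval off itself, then the double commutator of \<open>f\<close> with two maps supported
  in that interval does not involve \<open>f\<close> any more.\<close>

lemma some_refl_pair:
  obtains a b c d where "0 \<le> a" "a < b" "b \<le> c" "c < d" "d \<le> 1" "b - a + (d - c) < 1"
    "refl_on_ivl a b \<circ> refl_on_ivl c d \<in> N"
proof -
  obtain f x e where f: "f \<in> N" and e: "0 < e" "0 \<le> x - e" "x + e \<le> 1"
    and disj: "\<And>y z. \<bar>y - x\<bar> < e \<Longrightarrow> \<bar>z - x\<bar> < e \<Longrightarrow> f y \<noteq> z"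
    using exists_displaced_interval by metis
  have fG: "f \<in> G" using f N_sub by blast
  \<comment> \<open>Both maps are supported in the displaced interval, and \<open>h\<close> carries
    the support of \<open>g\<close> to the disjoint interval
    \<open>]x + 3e/4, x + e[\<close>.\<close>
  define g where "g = refl_on_ivl x (x + e / 4)"
  define h where "h = refl_on_ivl x (x + e)"
  have gG: "g \<in> G" and hG: "h \<in> G" using e by (auto simp: g_def h_def intro!: refl_G)
  have inv: "inv g = g" "inv h = h" by (simp_all add: g_def h_def)
  \<comment> \<open>The commutator of \<open>f\<close> and \<open>g\<close> equals \<open>g\<close>
    on \<open>?I\<close>, since \<open>inv f\<close> moves \<open>?I\<close> off itself. Off
    \<open>?I\<close> it is the involution \<open>f \<circ> g \<circ> inv f\<close>, which stays off
    \<open>?I\<close>, where \<open>h\<close> is trivial. So \<open>c\<close> is an involution, and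
    its commutator with \<open>h\<close> reduces to that of \<open>h\<close> and
    \<open>g\<close>.\<close>
  define c where "c = f \<circ> (g \<circ> inv f \<circ> inv g)"
  have cN: "c \<in> N" unfolding c_def using f gG by (intro N_comp N_conj N_inv)
  have hcN: "(h \<circ> c \<circ> inv h) \<circ> c \<in> N" using cN hG by (intro N_comp N_conj)
  let ?I = "{x - e<..<x + e}"
  have gI: "g y \<in> ?I \<longleftrightarrow> y \<in> ?I" "y \<notin> ?I \<Longrightarrow> g y = y" for y using e by (auto simp: g_def refl_on_ivl_def)
  have hI: "h y \<in> ?I \<longleftrightarrow> y \<in> ?I" "y \<notin> ?I \<Longrightarrow> h y = y" for y using e by (auto simp: h_def refl_on_ivl_def)
  have gg: "g (g y) = y" and hh: "h (h y) = y" for y by (simp_all add: g_def h_def)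
  have c_in: "c y = g y" if "y \<in> ?I" for y
  proof -
    have "inv f (g y) \<notin> ?I"
    proof
      assume "inv f (g y) \<in> ?I"
      moreover have "g y \<in> ?I" using that gI by blast
      ultimately have "f (inv f (g y)) \<noteq> g y" using disj by (auto simp: abs_if)
      then show False using fG by (simp add: perm_X_f_inv G_perm)
    qed
    then show ?thesis using fG by (simp add: c_def inv gI perm_X_f_inv G_perm)
  qed
  have c_out: "c y = f (g (inv f y))" if "y \<notin> ?I" for y
    using that gI by (simp add: c_def inv)
  have c_out': "c y \<notin> ?I" "c (c y) = y" if y: "y \<notin> ?I" for y
  proof -
    show "c y \<notin> ?I"
    proof
      assume *: "c y \<in> ?I"
      have "g (inv f y) \<notin> ?I"
      proof
        assume "g (inv f y) \<in> ?I"
        then have "f (g (inv f y)) \<noteq> c y" using * by (intro disj) auto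
        then show False using c_out[OF y] by simp
      qed
      then have "g (inv f y) = inv f y" using gI by (metis gg)
      then have "c y = y" using c_out[OF y] fG by (simp add: perm_X_f_inv G_perm)
      then show False using * y by simp
    qed
    then show "c (c y) = y" using c_out y fG by (simp add: perm_X_f_inv perm_X_inv_f G_perm gg)
  qed
  have "(h \<circ> c \<circ> inv h) \<circ> c = h \<circ> g \<circ> h \<circ> g"
  proof
    fix y
    show "((h \<circ> c \<circ> inv h) \<circ> c) y = (h \<circ> g \<circ> h \<circ> g) y"
    proof (cases "y \<in> ?I")
      case True
      then have "g y \<in> ?I" "h (g y) \<in> ?I" using gI(1) hI(1) by blast+
      then have "c y = g y" "c (h (g y)) = g (h (g y))" using True c_in by blast+
      then show ?thesis by (simp add: inv)
    next
      case False
      have "h (c y) = c y" by (rule hI(2)[OF c_out'(1)[OF False]])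
      moreover have "h y = y" "g y = y" "c (c y) = y" using gI(2) hI(2) c_out'(2) False by blast+
      ultimately show ?thesis by (simp add: inv)
    qed
  qed
  also have "h \<circ> g \<circ> h = h \<circ> g \<circ> inv h" by (simp add: inv)
  also have "\<dots> = refl_on_ivl (2 * x + e - (x + e / 4)) (2 * x + e - x)"
    unfolding g_def by (rule conj_refl_decr) (use e in \<open>auto simp: h_def refl_on_ivl_def\<close>)
  also have "2 * x + e - (x + e / 4) = x + 3 / 4 * e" by simp
  also have "2 * x + e - x = x + e" by simp
  finally have "refl_on_ivl (x + 3 / 4 * e) (x + e) \<circ> refl_on_ivl x (x + e / 4) \<in> N"
    using hcN unfolding g_def by (simp only:)
  also have "refl_on_ivl (x + 3 / 4 * e) (x + e) \<circ> refl_on_ivl x (x + e / 4)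
      = refl_on_ivl x (x + e / 4) \<circ> refl_on_ivl (x + 3 / 4 * e) (x + e)"
    using e by (auto simp: fun_eq_iff refl_on_ivl_def)
  finally have pair: "refl_on_ivl x (x + e / 4) \<circ> refl_on_ivl (x + 3 / 4 * e) (x + e) \<in> N" .
  show thesis by (rule that[OF _ _ _ _ _ _ pair]) (use e in auto)
qed

section \<open>Reflections in the normal subgroup\<close>

lemma conj_comp:
  assumes "bij k" shows "k \<circ> (f \<circ> g) \<circ> inv k = (k \<circ> f \<circ> inv k) \<circ> (k \<circ> g \<circ> inv k)"
  using assms by (simp add: fun_eq_iff bij_is_inj)

text \<open>Four conjugations: move the first interval to the left end, bring the second next to it,
  shrink or stretch their union \<open>]0, m[\<close> to \<open>]0, 1/2[\<close>, and equalize the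
  two lengths. A total length below 1 makes room for the third.\<close>

lemma refl_pair_normal_form:
  assumes "0 \<le> a" "a < b" "b \<le> c" "c < d" "d \<le> 1" "b - a + (d - c) < 1"
  shows "refl_on_ivl a b \<circ> refl_on_ivl c d \<in> N \<longleftrightarrow>
    refl_on_ivl 0 (1 / 4) \<circ> refl_on_ivl (1 / 4) (1 / 2) \<in> N"
proof -
  define l where "l = b - a"
  define m where "m = l + (d - c)"
  \<comment> \<open>The place of the common end point \<open>l\<close> after rescaling by
    \<open>1 / (2 * m)\<close>.\<close>
  define p where "p = l / (2 * m)"
  have lm: "0 < l" "l < m" "m < 1" "l \<le> c" using assms by (auto simp: l_def m_def)
  have p: "0 < p" "p < 1 / 2" using lm by (auto simp: p_def field_simps)
  let ?k = "refl_on_ivl 0 b"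
  have kG: "?k \<in> G" using assms by (intro refl_G) auto
  have "?k \<circ> refl_on_ivl a b \<circ> inv ?k = refl_on_ivl (b - b) (b - a)"
    by (rule conj_refl_decr) (use assms in \<open>auto simp: refl_on_ivl_def\<close>)
  moreover have "?k \<circ> refl_on_ivl c d \<circ> inv ?k = refl_on_ivl (1 * c + 0) (1 * d + 0)"
    by (rule conj_refl_incr) (use assms in \<open>auto simp: refl_on_ivl_def\<close>)
  ultimately have "refl_on_ivl a b \<circ> refl_on_ivl c d \<in> N \<longleftrightarrow> refl_on_ivl 0 l \<circ> refl_on_ivl c d \<in> N"
    using N_conj_iff[OF kG, of "refl_on_ivl a b \<circ> refl_on_ivl c d"]
    unfolding conj_comp[OF G_bij[OF kG]] by (simp add: l_def)
  also have "\<dots> \<longleftrightarrow> refl_on_ivl 0 l \<circ> refl_on_ivl l m \<in> N"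
  proof -
    let ?k = "refl_on_ivl l d"
    have kG: "?k \<in> G" using assms lm by (intro refl_G) auto
    have "?k \<circ> refl_on_ivl 0 l \<circ> inv ?k = refl_on_ivl (1 * 0 + 0) (1 * l + 0)"
      by (rule conj_refl_incr) (use assms in \<open>auto simp: refl_on_ivl_def\<close>)
    moreover have "?k \<circ> refl_on_ivl c d \<circ> inv ?k = refl_on_ivl (l + d - d) (l + d - c)"
      by (rule conj_refl_decr) (use assms lm in \<open>auto simp: refl_on_ivl_def\<close>)
    ultimately show ?thesis
      using N_conj_iff[OF kG, of "refl_on_ivl 0 l \<circ> refl_on_ivl c d"]
      unfolding conj_comp[OF G_bij[OF kG]] by (simp add: m_def algebra_simps)
  qed
  also have "\<dots> \<longleftrightarrow> refl_on_ivl 0 p \<circ> refl_on_ivl p (1 / 2) \<in> N"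
  proof -
    let ?k = "two_piece 1 m (1 / 2)"
    have kG: "?k \<in> G" using lm by (intro two_piece_G) auto
    have "?k \<circ> refl_on_ivl 0 l \<circ> inv ?k = refl_on_ivl (1 / 2 / m * 0 + 0) (1 / 2 / m * l + 0)"
      by (rule conj_refl_incr) (use lm G_bij[OF kG] in \<open>auto simp: two_piece_left\<close>)
    moreover have "?k \<circ> refl_on_ivl l m \<circ> inv ?k = refl_on_ivl (1 / 2 / m * l + 0) (1 / 2 / m * m + 0)"
      by (rule conj_refl_incr) (use lm G_bij[OF kG] in \<open>auto simp: two_piece_left\<close>)
    moreover have "1 / 2 / m * l + 0 = p" "1 / 2 / m * m + 0 = 1 / 2" using lm by (auto simp: p_def)
    ultimately show ?thesis
      using N_conj_iff[OF kG, of "refl_on_ivl 0 l \<circ> refl_on_ivl l m"]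
      unfolding conj_comp[OF G_bij[OF kG]] by (simp only: mult_zero_right add_0_right)
  qed
  also have "\<dots> \<longleftrightarrow> refl_on_ivl 0 (1 / 4) \<circ> refl_on_ivl (1 / 4) (1 / 2) \<in> N"
  proof -
    let ?k = "two_piece (1 / 2) p (1 / 4)"
    let ?s = "(1 / 2 - 1 / 4) / (1 / 2 - p)"
    have kG: "?k \<in> G" using p by (intro two_piece_G) auto
    have s: "?s > 0" using p by simp
    have "?k \<circ> refl_on_ivl 0 p \<circ> inv ?k = refl_on_ivl (1 / 4 / p * 0 + 0) (1 / 4 / p * p + 0)"
      by (rule conj_refl_incr) (use p G_bij[OF kG] in \<open>auto simp: two_piece_left\<close>)
    moreover have "?k \<circ> refl_on_ivl p (1 / 2) \<circ> inv ?k
        = refl_on_ivl (?s * p + (1 / 2 - 1 / 2 * ?s)) (?s * (1 / 2) + (1 / 2 - 1 / 2 * ?s))"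
    proof (rule conj_refl_incr)
      show "?k x = ?s * x + (1 / 2 - 1 / 2 * ?s)" if "p < x" "x < 1 / 2" for x
      proof -
        have "?k x = 1 / 2 - (1 / 2 - x) * ?s" using that p by (intro two_piece_right) auto
        then show ?thesis by algebra
      qed
    qed (use s G_bij[OF kG] in auto)
    moreover have "?s * p + (1 / 2 - 1 / 2 * ?s) = 1 / 4"
    proof -
      have "?s * p + (1 / 2 - 1 / 2 * ?s) = 1 / 2 - (1 / 2 - p) * ?s" by algebra
      also have "(1 / 2 - p) * ?s = 1 / 4" using p by simp
      finally show ?thesis by simp
    qed
    moreover have "?s * (1 / 2) + (1 / 2 - 1 / 2 * ?s) = 1 / 2" by algebra
    moreover have "1 / 4 / p * 0 + 0 = (0::real)" "1 / 4 / p * p + 0 = 1 / 4" using p by auto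
    ultimately have "?k \<circ> (refl_on_ivl 0 p \<circ> refl_on_ivl p (1 / 2)) \<circ> inv ?k
        = refl_on_ivl 0 (1 / 4) \<circ> refl_on_ivl (1 / 4) (1 / 2)"
      unfolding conj_comp[OF G_bij[OF kG]] by (simp only:)
    then show ?thesis
      using N_conj_iff[OF kG, of "refl_on_ivl 0 p \<circ> refl_on_ivl p (1 / 2)"] by (simp only:)
  qed
  finally show ?thesis .
qed

lemma refl_pair_N:
  assumes "0 \<le> a" "a < b" "b \<le> c" "c < d" "d \<le> 1" "b - a + (d - c) < 1"
  shows "refl_on_ivl a b \<circ> refl_on_ivl c d \<in> N"
  using some_refl_pair refl_pair_normal_form refl_pair_normal_form[OF assms] by metis

lemma refl_quarter_N: "refl_on_ivl 0 (1 / 4) \<in> N"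
proof -
  define w where "w = refl_on_ivl 0 (1 / 2) \<circ> refl_on_ivl (1 / 8) (3 / 8)"
  \<comment> \<open>Off the break points, \<open>w\<close> exchanges \<open>]0, 1/8[\<close> and
    \<open>]3/8, 1/2[\<close> by \<open>x \<mapsto> 1/2 - x\<close>, the two concentric flips
    cancelling in the middle. As \<open>k\<close> fixes \<open>]0, 1/8[\<close> and translates
    \<open>]3/8, 1/2[\<close> to \<open>]1/8, 1/4[\<close>, the conjugate of \<open>w\<close>
    reflects \<open>]0, 1/4[\<close>.\<close>
  define k where "k = refl_on_ivl (1 / 8) (1 / 4) \<circ> refl_on_ivl (1 / 8) (1 / 2)"
  \<comment> \<open>The auxiliary reflection of \<open>]1/2, 3/4[\<close> is disjoint from the other
    intervals and cancels with its second occurrence.\<close>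
  have "(refl_on_ivl 0 (1 / 2) \<circ> refl_on_ivl (1 / 2) (3 / 4))
      \<circ> (refl_on_ivl (1 / 8) (3 / 8) \<circ> refl_on_ivl (1 / 2) (3 / 4)) \<in> N"
    by (intro N_comp refl_pair_N) auto
  also have "(refl_on_ivl 0 (1 / 2) \<circ> refl_on_ivl (1 / 2) (3 / 4))
      \<circ> (refl_on_ivl (1 / 8) (3 / 8) \<circ> refl_on_ivl (1 / 2) (3 / 4)) = w"
    by (auto simp: w_def fun_eq_iff refl_on_ivl_def)
  finally have wN: "w \<in> N" .
  have kG: "k \<in> G" unfolding k_def by (intro G_comp refl_G) auto
  have invk: "inv k = refl_on_ivl (1 / 8) (1 / 2) \<circ> refl_on_ivl (1 / 8) (1 / 4)"
    unfolding k_def by (rule inv_equality) auto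
  have w: "w x = (if 0 < x \<and> x < 1/8 \<or> 3/8 < x \<and> x < 1/2 then 1/2 - x else x)"
    if "x \<noteq> 1/8" "x \<noteq> 3/8" for x
    using that by (auto simp: w_def refl_on_ivl_def)
  have ki: "inv k x = (if 1/8 < x \<and> x < 1/4 then x + 1/4 else if 1/4 < x \<and> x < 1/2 then 5/8 - x else x)"
    if "x \<noteq> 1/4" for x
    using that by (auto simp: invk refl_on_ivl_def)
  have k: "k x = (if 3/8 < x \<and> x < 1/2 then x - 1/4 else if 1/8 < x \<and> x < 3/8 then 5/8 - x else x)"
    if "x \<noteq> 3/8" for x
    using that by (auto simp: k_def refl_on_ivl_def)
  have "finite {x. (k \<circ> w \<circ> inv k) x \<noteq> refl_on_ivl 0 (1 / 4) x}"
  proof (rule finite_subset)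
    show "{x. (k \<circ> w \<circ> inv k) x \<noteq> refl_on_ivl 0 (1 / 4) x} \<subseteq> {0, 1/8, 1/4, 3/8, 1/2}"
    proof
      fix x :: real assume "x \<in> {x. (k \<circ> w \<circ> inv k) x \<noteq> refl_on_ivl 0 (1 / 4) x}"
      moreover have "(k \<circ> w \<circ> inv k) x = refl_on_ivl 0 (1 / 4) x"
        if ne: "x \<noteq> 0" "x \<noteq> 1/8" "x \<noteq> 1/4" "x \<noteq> 3/8" "x \<noteq> 1/2"
      proof -
        consider "x < 0 \<or> 1/2 < x" | "0 < x" "x < 1/8" | "1/8 < x" "x < 1/4" | "1/4 < x" "x < 1/2"
          using ne by linarith
        then show ?thesis
        proof cases
          case 1 then show ?thesis by (auto simp: ki w k refl_on_ivl_def)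
        next
          case 2 then show ?thesis by (simp add: ki w k refl_on_ivl_def)
        next
          case 3 then show ?thesis by (simp add: ki w k refl_on_ivl_def)
        next
          case 4 then show ?thesis using ne by (simp add: ki w k refl_on_ivl_def)
        qed
      qed
      ultimately show "x \<in> {0, 1/8, 1/4, 3/8, 1/2}" by auto
    qed
  qed simp
  then show ?thesis using N_conj[OF wN kG] refl_perm[of 0 "1/4"] N_congruent by simp
qed

text \<open>The reflection of \<open>]0, 1/4[\<close> is conjugated to that of \<open>]0, m[\<close>
  by a stretching, which exists for \<open>m < 1\<close>; the flip of \<open>]0, b[\<close> then
  exchanges \<open>]0, b - a[\<close> and \<open>]a, b[\<close>.\<close>

lemma refl_proper_N: assumes "0 \<le> a" "a < b" "b \<le> 1" "b - a < 1" shows "refl_on_ivl a b \<in> N"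
proof -
  define m where "m = b - a"
  have m: "0 < m" "m < 1" using assms by (auto simp: m_def)
  let ?k = "two_piece 1 (1 / 4) m"
  have kG: "?k \<in> G" using m by (intro two_piece_G) auto
  have "?k \<circ> refl_on_ivl 0 (1 / 4) \<circ> inv ?k = refl_on_ivl (4 * m * 0 + 0) (4 * m * (1 / 4) + 0)"
    by (rule conj_refl_incr) (use m G_bij[OF kG] in \<open>auto simp: two_piece_left\<close>)
  then have 0: "refl_on_ivl 0 m \<in> N" using N_conj[OF refl_quarter_N kG] by simp
  have kG: "refl_on_ivl 0 b \<in> G" using assms by (intro refl_G) auto
  have "refl_on_ivl 0 b \<circ> refl_on_ivl a b \<circ> inv (refl_on_ivl 0 b) = refl_on_ivl (b - b) (b - a)"
    by (rule conj_refl_decr) (use assms in \<open>auto simp: refl_on_ivl_def\<close>)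
  then show ?thesis using 0 N_unconj[OF _ kG] by (simp add: m_def)
qed

text \<open>The middle half is reflected first. The other five factors form the conjugate of the
  reflection of \<open>]0, 1/2[\<close> by a map that fixes \<open>]0, 1/4[\<close> and translates
  \<open>]1/4, 1/2[\<close> to \<open>]3/4, 1[\<close>; this conjugate exchanges the outer quarters
  by \<open>x \<mapsto> 1 - x\<close>.\<close>

lemma refl_whole_N: "refl_on_ivl 0 1 \<in> N"
proof -
  define w where "w = refl_on_ivl (1/4) 1 \<circ> refl_on_ivl (1/4) (1/2) \<circ> refl_on_ivl 0 (1/2)
      \<circ> refl_on_ivl (1/4) (1/2) \<circ> refl_on_ivl (1/4) 1 \<circ> refl_on_ivl (1/4) (3/4)"
  have wN: "w \<in> N" unfolding w_def by (intro N_comp refl_proper_N) auto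
  have "finite {x. w x \<noteq> refl_on_ivl 0 1 x}"
  proof (rule finite_subset)
    show "{x. w x \<noteq> refl_on_ivl 0 1 x} \<subseteq> {0, 1/4, 1/2, 3/4, 1}"
    proof
      fix x :: real assume "x \<in> {x. w x \<noteq> refl_on_ivl 0 1 x}"
      moreover have "w x = refl_on_ivl 0 1 x"
        if ne: "x \<noteq> 0" "x \<noteq> 1/4" "x \<noteq> 1/2" "x \<noteq> 3/4" "x \<noteq> 1"
      proof -
        consider "x < 0 \<or> 1 < x" | "0 < x" "x < 1/4" | "1/4 < x" "x < 1/2"
          | "1/2 < x" "x < 3/4" | "3/4 < x" "x < 1"
          using ne by linarith
        then show ?thesis
          by cases (auto simp: w_def refl_on_ivl_def)
      qed
      ultimately show "x \<in> {0, 1/4, 1/2, 3/4, 1}" by auto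
    qed
  qed simp
  then show ?thesis using wN refl_perm[of 0 1] N_congruent by simp
qed

lemma refl_N: assumes "0 \<le> a" "a < b" "b \<le> 1" shows "refl_on_ivl a b \<in> N"
proof (cases "b - a < 1")
  case False
  then have "a = 0" "b = 1" using assms by auto
  then show ?thesis by (simp add: refl_whole_N)
qed (use assms refl_proper_N in auto)

text \<open>The conjugator is the map of \<open>halving_word\<close>, which lies in \<open>N\<close>
  and equals \<open>x / 2\<close> on the support \<open>]0, m[\<close>. The bound on
  \<open>m\<close> leaves room for the reflection of \<open>]0, 3m/2[\<close>.\<close>

lemma two_piece_half_scale:
  assumes pq: "0 < p" "p < m" "0 < q" "q < m" and "m \<le> 1 / 2"
  obtains k where "k \<in> N"
    "k \<circ> two_piece m p q \<circ> inv k = two_piece (m / 2) (p / 2) (q / 2)"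
proof -
  define r where "r = refl_on_ivl 0 (3 * m / 2)"
  define h where "h = two_piece (3 * m / 2) m (3 * m / 4)"
  define k where "k = r \<circ> (inv h \<circ> r \<circ> inv (inv h))"
  have m: "m > 0" using pq by simp
  have rN: "r \<in> N" unfolding r_def using assms by (intro refl_N) auto
  have hG: "h \<in> G" unfolding h_def using assms m by (intro two_piece_G) auto
  have kN: "k \<in> N" unfolding k_def using rN hG by (intro N_comp N_conj G_inv)
  have inv: "inv h = two_piece (3 * m / 2) (3 * m / 4) m"
    unfolding h_def using m by (intro inv_two_piece) auto
  have k: "k x = x / 2" if "0 < x" "x < m" for x
  proof -
    have "k x = r (inv h (r (h x)))" using G_bij[OF hG] by (simp add: k_def inv_inv_eq)
    then show ?thesis using halving_word[OF that] unfolding inv by (simp only: r_def h_def)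
  qed
  have bk: "bij k" using kN N_sub G_bij by blast
  have "k \<circ> two_piece m p q \<circ> inv k = two_piece (m / 2) (p / 2) (q / 2)"
  proof
    fix y
    obtain x where y: "y = k x" using bk by (metis bij_pointE)
    have invk: "inv k y = x" using y bk by (simp add: bij_is_inj)
    show "(k \<circ> two_piece m p q \<circ> inv k) y = two_piece (m / 2) (p / 2) (q / 2) y"
    proof (cases "0 < x \<and> x < m")
      case True
      have "0 < two_piece m p q x \<and> two_piece m p q x < m"
      proof (rule ccontr)
        assume "\<not> (0 < two_piece m p q x \<and> two_piece m p q x < m)"
        then have "two_piece m q p (two_piece m p q x) = two_piece m p q x"
          by (intro two_piece_outside) auto
        then have "two_piece m p q x = x" using pq by (simp add: two_piece_inverse)
        then show False using True \<open>\<not> _\<close> by simp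
      qed
      then have "k (two_piece m p q x) = two_piece m p q x / 2" using k by blast
      moreover have "y = x / 2" using True k y by blast
      ultimately show ?thesis using invk by (simp only: comp_apply two_piece_half)
    next
      case False
      have "\<not> (0 < y \<and> y < m / 2)"
      proof
        assume *: "0 < y \<and> y < m / 2"
        then have "k (2 * y) = k x" using k[of "2 * y"] y by simp
        then have "x = 2 * y" using bk by (metis bij_is_inj injD)
        then show False using * False by simp
      qed
      then have "two_piece (m / 2) (p / 2) (q / 2) y = y" by (intro two_piece_outside) auto
      moreover have "two_piece m p q x = x" using False by (intro two_piece_outside) auto
      ultimately show ?thesis using y invk by simp
    qed
  qed
  then show thesis using kN that by blast
qed

section \<open>Congruence modulo \<open>N\<close> and two-piece maps\<close>

lemma G_inverse_simps:
  "f \<in> G \<Longrightarrow> inv f (f x) = x" "f \<in> G \<Longrightarrow> f (inv f x) = x"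
  by (simp_all add: G_perm perm_X_inv_f perm_X_f_inv)

definition cong_N :: "(real \<Rightarrow> real) \<Rightarrow> (real \<Rightarrow> real) \<Rightarrow> bool" where
  "cong_N f g \<longleftrightarrow> f \<in> G \<and> g \<in> G \<and> f \<circ> inv g \<in> N"

lemma id_N: "id \<in> N"
proof -
  have "id \<in> Sfin" by (auto simp: Sfin_def perm_X_iff)
  then show ?thesis using Sfin_sub by blast
qed

lemma cong_N_id_iff: "cong_N f id \<longleftrightarrow> f \<in> N"
  using N_sub id_N by (auto simp: cong_N_def)

lemma cong_N_sym: assumes "cong_N f g" shows "cong_N g f"
proof -
  have fg: "f \<in> G" "g \<in> G" "f \<circ> inv g \<in> N" using assms by (auto simp: cong_N_def)
  have "inv (f \<circ> inv g) = g \<circ> inv f"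
    by (rule inv_equality) (use fg in \<open>auto simp: G_inverse_simps\<close>)
  then show ?thesis using N_inv[OF fg(3)] fg by (simp add: cong_N_def)
qed

lemma cong_N_trans: assumes "cong_N f g" "cong_N g h" shows "cong_N f h"
proof -
  have "(f \<circ> inv g) \<circ> (g \<circ> inv h) \<in> N" using assms by (auto simp: cong_N_def intro: N_comp)
  moreover have "(f \<circ> inv g) \<circ> (g \<circ> inv h) = f \<circ> inv h"
    using assms by (auto simp: cong_N_def fun_eq_iff G_inverse_simps)
  ultimately show ?thesis using assms by (simp add: cong_N_def)
qed

text \<open>This is where normality enters: the quotient of the two products is a conjugate of
  \<open>f' \<circ> inv g'\<close> by \<open>f\<close>, followed on the right by
  \<open>f \<circ> inv g\<close>.\<close>

lemma cong_N_comp: assumes "cong_N f g" "cong_N f' g'" shows "cong_N (f \<circ> f') (g \<circ> g')"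
proof -
  have G: "f \<in> G" "f' \<in> G" "g \<in> G" "g' \<in> G" using assms by (auto simp: cong_N_def)
  have "(f \<circ> (f' \<circ> inv g') \<circ> inv f) \<circ> (f \<circ> inv g) \<in> N"
    using assms by (auto simp: cong_N_def intro!: N_comp N_conj)
  moreover have "(f \<circ> (f' \<circ> inv g') \<circ> inv f) \<circ> (f \<circ> inv g) = (f \<circ> f') \<circ> inv (g \<circ> g')"
    using G by (auto simp: fun_eq_iff G_inverse_simps o_inv_distrib G_bij)
  ultimately show ?thesis using G by (simp add: cong_N_def G_comp)
qed

lemma cong_N_finite:
  assumes "f \<in> G" "g \<in> G" "finite {x. f x \<noteq> g x}" shows "cong_N f g"
proof -
  have "{x. (f \<circ> inv g) x \<noteq> x} \<subseteq> g ` {x. f x \<noteq> g x}"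
  proof
    fix x assume "x \<in> {x. (f \<circ> inv g) x \<noteq> x}"
    then show "x \<in> g ` {x. f x \<noteq> g x}"
      using assms by (intro image_eqI[of _ _ "inv g x"]) (auto simp: G_inverse_simps)
  qed
  then have "finite {x. (f \<circ> inv g) x \<noteq> x}" by (rule finite_subset) (use assms in simp)
  then have "f \<circ> inv g \<in> Sfin" using assms by (simp add: Sfin_def G_perm perm_X_comp perm_X_inv)
  then show ?thesis using assms Sfin_sub by (auto simp: cong_N_def)
qed

text \<open>Deleting the reflections, which lie in \<open>N\<close>, from the word of
  \<open>two_piece_doubling\<close> leaves \<open>h \<circ> h\<close>.\<close>

lemma two_piece_cong_square:
  assumes pq: "0 < p" "p < m" "0 < q" "q < m" and "m \<le> 1"
  defines "h \<equiv> two_piece (m / 2) (p / 2) (q / 2)"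
  shows "cong_N (h \<circ> h) (two_piece m p q)"
proof -
  let ?r = "refl_on_ivl 0 m" and ?r\<^sub>p = "refl_on_ivl (p / 2) m" and ?r\<^sub>q = "refl_on_ivl (q / 2) m"
  have hG: "h \<in> G" and HG: "two_piece m p q \<in> G"
    unfolding h_def using assms by (auto intro!: two_piece_G)
  have N: "?r \<in> N" "?r\<^sub>p \<in> N" "?r\<^sub>q \<in> N" using assms by (auto intro!: refl_N)
  have h: "cong_N h h" using hG by (intro cong_N_finite) auto
  have "cong_N (?r\<^sub>q \<circ> (h \<circ> (?r \<circ> (h \<circ> (?r \<circ> ?r\<^sub>p))))) (id \<circ> (h \<circ> (id \<circ> (h \<circ> (id \<circ> id)))))"
    using N h by (intro cong_N_comp) (auto simp: cong_N_id_iff)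
  then have 1: "cong_N (?r\<^sub>q \<circ> (h \<circ> (?r \<circ> (h \<circ> (?r \<circ> ?r\<^sub>p))))) (h \<circ> h)"
    by (simp only: id_o o_id)
  have 2: "cong_N (?r\<^sub>q \<circ> (h \<circ> (?r \<circ> (h \<circ> (?r \<circ> ?r\<^sub>p))))) (two_piece m p q)"
  proof (rule cong_N_finite)
    show "?r\<^sub>q \<circ> (h \<circ> (?r \<circ> (h \<circ> (?r \<circ> ?r\<^sub>p)))) \<in> G" by (intro G_comp hG subsetD[OF N_sub] N)
    have "{x. (?r\<^sub>q \<circ> (h \<circ> (?r \<circ> (h \<circ> (?r \<circ> ?r\<^sub>p))))) x \<noteq> two_piece m p q x} \<subseteq> {0, p / 2, p, m}"
      using two_piece_doubling[OF pq] unfolding comp_def h_def by blast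
    then show "finite {x. (?r\<^sub>q \<circ> (h \<circ> (?r \<circ> (h \<circ> (?r \<circ> ?r\<^sub>p))))) x \<noteq> two_piece m p q x}"
      by (rule finite_subset) simp
  qed (rule HG)
  show ?thesis by (rule cong_N_trans[OF cong_N_sym[OF 1] 2])
qed

text \<open>Conjugation by an element of \<open>N\<close> makes the half-scale copy congruent to
  \<open>?H\<close>, while its square is congruent to \<open>?H\<close>. So \<open>?H\<close> is
  congruent to its own square, hence trivial modulo \<open>N\<close>.\<close>

lemma two_piece_half_N:
  assumes pq: "0 < p" "p < m" "0 < q" "q < m" and "m \<le> 1 / 2"
  shows "two_piece m p q \<in> N"
proof -
  let ?H = "two_piece m p q" and ?h = "two_piece (m / 2) (p / 2) (q / 2)"
  obtain k where k: "k \<in> N" "k \<circ> ?H \<circ> inv k = ?h" using two_piece_half_scale[OF assms] by metis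
  have HG: "?H \<in> G" using assms by (intro two_piece_G) auto
  have HH: "cong_N ?H ?H" using HG by (intro cong_N_finite) auto
  have "cong_N (k \<circ> ?H \<circ> inv k) (id \<circ> ?H \<circ> id)"
    using k HH N_inv by (intro cong_N_comp) (auto simp: cong_N_id_iff)
  then have hH: "cong_N ?h ?H" using k by simp
  have "cong_N (?h \<circ> ?h) ?H" using assms by (intro two_piece_cong_square) auto
  then have "cong_N (?H \<circ> ?H) ?H" using cong_N_comp[OF hH hH] cong_N_sym cong_N_trans by blast
  moreover have "(?H \<circ> ?H) \<circ> inv ?H = ?H" using HG by (simp add: fun_eq_iff G_inverse_simps)
  ultimately show ?thesis by (simp add: cong_N_def)
qed

text \<open>For \<open>m\<close> up to 1 the half-scale copy falls under the previous case, and the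
  given map is congruent to its square.\<close>

lemma two_piece_N:
  assumes pq: "0 < p" "p < m" "0 < q" "q < m" and "m \<le> 1"
  shows "two_piece m p q \<in> N"
proof -
  let ?h = "two_piece (m / 2) (p / 2) (q / 2)"
  have "?h \<in> N" using assms by (intro two_piece_half_N) auto
  then have "cong_N (?h \<circ> ?h) id" by (simp add: cong_N_id_iff N_comp)
  then show ?thesis
    using two_piece_cong_square[OF assms] cong_N_sym cong_N_trans cong_N_id_iff by blast
qed

end

subsection \<open>Elimination of the pieces of a permutation\<close>

lemma open_injective_image:
  fixes f :: "real \<Rightarrow> real"
  assumes "continuous_on {u<..<v} f" "inj f"
  shows "open (f ` {u<..<v})"
proof -
  have "is_interval {u<..<v}" by (simp add: is_interval_1)
  moreover have "inj_on f {u<..<v}" using assms(2) by (rule inj_on_subset) simp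
  ultimately show ?thesis
    using injective_eq_1d_open_map_UNIV[OF assms(1)] by (metis open_greaterThanLessThan subset_refl)
qed

text \<open>The image is open, connected and bounded, hence the open interval between its infimum
  and supremum.\<close>

lemma open_bounded_interval_image:
  fixes f :: "real \<Rightarrow> real"
  assumes c: "continuous_on {u<..<v} f" and "inj f" "u < v" and bd: "f ` {u<..<v} \<subseteq> {l..h}"
  obtains c d where "c < d" "f ` {u<..<v} = {c<..<d}"
proof -
  let ?S = "f ` {u<..<v}"
  have op: "open ?S" using assms by (intro open_injective_image)
  have ne: "?S \<noteq> {}" using \<open>u < v\<close> by simp
  have conn: "connected ?S" by (rule connected_continuous_image[OF c]) simp
  have bdd: "bdd_above ?S" "bdd_below ?S"
    using bd by (meson bdd_above_mono bdd_above_Icc bdd_below_mono bdd_below_Icc)+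
  have "?S = {Inf ?S<..<Sup ?S}"
  proof (intro equalityI subsetI)
    fix y assume "y \<in> ?S"
    then obtain e where e: "e > 0" "\<And>z. dist z y < e \<Longrightarrow> z \<in> ?S" using op unfolding open_dist by blast
    have "y - e / 2 \<in> ?S" "y + e / 2 \<in> ?S" using e(1) by (auto intro!: e(2) simp: dist_real_def)
    then have "Inf ?S \<le> y - e / 2" "y + e / 2 \<le> Sup ?S" using bdd by (meson cInf_lower cSup_upper)+
    then show "y \<in> {Inf ?S<..<Sup ?S}" using e(1) by simp
  next
    fix y assume y: "y \<in> {Inf ?S<..<Sup ?S}"
    then obtain l h where "l \<in> ?S" "l < y" "h \<in> ?S" "y < h"
      using cInf_less_iff[OF ne bdd(2)] less_cSup_iff[OF ne bdd(1)] by (metis greaterThanLessThan_iff)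
    then show "y \<in> ?S" using connectedD_interval[OF conn, of l h y] by simp
  qed
  moreover have "Inf ?S < Sup ?S" using ne calculation by (metis greaterThanLessThan_empty_iff not_le)
  ultimately show thesis using that by blast
qed

lemma (in local_regularity) P_continuous_on:
  "(\<And>x. x \<in> S \<Longrightarrow> P f x) \<Longrightarrow> continuous_on S f"
  by (simp add: cont continuous_at_imp_continuous_on)

context noncentral_normal
begin

text \<open>Reflections put the image of the last piece \<open>]b, a[\<close>, with increasing orientation, at the
  right end of \<open>]0, a[\<close>, and a two-piece map then rescales it to \<open>]b, a[\<close>. All of these are affine off
  the end points of the image of the piece, so the other pieces are not cut.\<close>

lemma return_last_piece:
  assumes fG: "f \<in> G" and ab: "0 \<le> b" "b < a" "a \<le> 1"
    and Pf: "\<And>x. x \<in> {b<..<a} \<Longrightarrow> P f x"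
    and fin: "finite {x \<in> {a<..<1}. f x \<noteq> x}"
  obtains g where "g \<in> N" "(g \<circ> f) ` {b<..<a} = {b<..<a}" "strict_mono_on {b<..<a} (g \<circ> f)"
    "\<And>x. x \<in> {b<..<a} \<Longrightarrow> P (g \<circ> f) x"
    "\<And>x. x \<in> {0<..<b} \<Longrightarrow> eventually (P f) (nhds x) \<Longrightarrow> P (g \<circ> f) x"
    "\<And>x. x > a \<Longrightarrow> f x = x \<Longrightarrow> (g \<circ> f) x = x"
proof -
  \<comment> \<open>Points of \<open>]a, 1[\<close> off \<open>E\<close> are fixed by
    \<open>f\<close>, so by injectivity points up to \<open>a\<close> take values in
    \<open>]a, 1[\<close> only inside the finite set \<open>E\<close>.\<close>
  define E where "E = {x \<in> {a<..<1}. f x \<noteq> x}"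
  have E: "finite E" using fin by (simp add: E_def)
  have perm: "perm_X f" and bf: "bij f" and inj: "inj f"
    using fG by (auto simp: G_perm G_bij bij_is_inj)
  have range: "0 \<le> f x" "f x < 1" if "0 \<le> x" "x < 1" for x
    using perm_X_range[OF perm, of x] that by (auto simp: Xint_def)
  have f_gt: "f x \<in> E" if "x \<le> a" "a < f x" "f x < 1" for x
  proof (rule ccontr)
    assume "f x \<notin> E"
    then have "f (f x) = f x" using that by (auto simp: E_def)
    then have "f x = x" using inj by (simp add: inj_eq)
    then show False using that by simp
  qed
  have cf: "continuous_on {b<..<a} f" using Pf by (rule P_continuous_on)
  obtain c d where cd: "c < d" "f ` {b<..<a} = {c<..<d}"
  proof (rule open_bounded_interval_image[OF cf inj ab(2), of 0 1])
    show "f ` {b<..<a} \<subseteq> {0..1}" using range ab by (fastforce simp: less_imp_le)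
  qed
  have fcd: "c < f x \<and> f x < d" if "b < x" "x < a" for x
  proof -
    have "f x \<in> f ` {b<..<a}" using that by (intro imageI) simp
    then show ?thesis by (simp add: cd)
  qed
  have cdf: "\<exists>x. b < x \<and> x < a \<and> y = f x" if "c < y" "y < d" for y
  proof -
    have "y \<in> f ` {b<..<a}" using that by (simp add: cd)
    then show ?thesis by auto
  qed
  have c0: "0 \<le> c"
  proof (rule ccontr)
    assume "\<not> 0 \<le> c"
    then obtain y where y: "c < y" "y < min 0 d" using dense[of c "min 0 d"] cd by auto
    then obtain x where "b < x" "x < a" "y = f x" using cdf by auto
    then show False using range[of x] ab y by auto
  qed
  have d1: "d \<le> 1"
  proof (rule ccontr)
    assume "\<not> d \<le> 1"
    then obtain y where y: "max 1 c < y" "y < d" using dense[of "max 1 c" d] cd by auto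
    then obtain x where "b < x" "x < a" "y = f x" using cdf by auto
    then show False using range[of x] ab y by auto
  qed
  have da: "d \<le> a"
  proof (rule ccontr)
    assume "\<not> d \<le> a"
    then have "infinite {max a c<..<d}" using cd by (intro infinite_Ioo) auto
    moreover have "{max a c<..<d} \<subseteq> E"
    proof
      fix y assume y: "y \<in> {max a c<..<d}"
      then obtain x where "b < x" "x < a" "y = f x" using cdf by auto
      then show "y \<in> E" using f_gt[of x] y d1 by auto
    qed
    ultimately show False using E finite_subset by blast
  qed
  \<comment> \<open>The flip of \<open>]c, a[\<close> carries the image \<open>]c, d[\<close> of the
    piece to \<open>]e, a[\<close>.\<close>
  define e where "e = c + a - d"
  have e: "c \<le> e" "e < a" using cd da by (auto simp: e_def)
  \<comment> \<open>If \<open>e\<close> were 0, the image of the last piece would fill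
    \<open>]0, a[\<close> and leave only finitely many values for the infinite set
    \<open>]0, b[\<close>.\<close>
  have e0: "e > 0" if b: "b > 0"
  proof (rule ccontr)
    assume "\<not> e > 0"
    then have "c = 0" "d = a" using e c0 da by (auto simp: e_def)
    have "f ` {0<..<b} \<subseteq> {0, a} \<union> E"
    proof
      fix y assume "y \<in> f ` {0<..<b}"
      then obtain x where x: "0 < x" "x < b" "y = f x" by auto
      have "\<not> (c < y \<and> y < d)"
      proof
        assume "c < y \<and> y < d"
        then obtain x' where "b < x'" "x' < a" "y = f x'" using cdf by auto
        then show False using x injD[OF inj, of x x'] by auto
      qed
      moreover have "0 \<le> y" "y < 1" using range[of x] x ab by auto
      ultimately show "y \<in> {0, a} \<union> E" using f_gt[of x] x ab \<open>c = 0\<close> \<open>d = a\<close> by force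
    qed
    then have "finite (f ` {0<..<b})" by (rule finite_subset) (use E in simp)
    then have "finite {0<..<b}" by (rule finite_imageD) (rule inj_on_subset[OF inj subset_UNIV])
    then show False using infinite_Ioo[of 0 b] b by simp
  qed
  \<comment> \<open>Conversely, when the piece is all of \<open>]0, a[\<close>, a gap left by its
    image would have to be covered by the images of finitely many points.\<close>
  have e0': "e = 0" if b: "b = 0"
  proof (rule ccontr)
    assume "e \<noteq> 0"
    then have "0 < c \<or> d < a" using e c0 by (auto simp: e_def)
    then have "infinite ({0<..<c} \<union> {d<..<a})" using infinite_Ioo by auto
    moreover have "inv f ` ({0<..<c} \<union> {d<..<a}) \<subseteq> {0, a} \<union> E"
    proof
      fix x assume "x \<in> inv f ` ({0<..<c} \<union> {d<..<a})"
      then obtain y where y: "y \<in> {0<..<c} \<union> {d<..<a}" "x = inv f y" by blast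
      have yx: "y = f x" using y perm by (simp add: perm_X_f_inv)
      have y01: "0 < y" "y < a" "\<not> (c < y \<and> y < d)" using y(1) c0 cd(1) da by auto
      have "x \<in> Xint" using perm_X_range[OF perm_X_inv[OF perm], of y] y01 y ab by (auto simp: Xint_def)
      moreover have "\<not> (b < x \<and> x < a)" using fcd[of x] yx y01 by auto
      ultimately show "x \<in> {0, a} \<union> E" using yx y01 b by (auto simp: E_def Xint_def)
    qed
    then have "finite (inv f ` ({0<..<c} \<union> {d<..<a}))" by (rule finite_subset) (use E in simp)
    then have "finite ({0<..<c} \<union> {d<..<a})"
      by (rule finite_imageD)
        (rule inj_on_subset[OF bij_is_inj[OF bij_imp_bij_inv[OF bf]] subset_UNIV])
    ultimately show False by blast
  qed
  \<comment> \<open>The flip \<open>g1\<close> reverses orientation. If \<open>f\<close> is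
    increasing on the piece, \<open>g2\<close> flips once more; if \<open>f\<close> is decreasing,
    \<open>g1 \<circ> f\<close> is already increasing. Then \<open>g3\<close> carries
    \<open>]e, a[\<close> onto \<open>]b, a[\<close>.\<close>
  define g1 where "g1 = refl_on_ivl c a"
  define g2 where "g2 = (if strict_mono_on {b<..<a} f then refl_on_ivl e a else id)"
  define g3 where "g3 = (if b = 0 then id else two_piece a e b)"
  define s where "s = (a - b) / (a - e)"
  have s: "s > 0" using ab e by (simp add: s_def)
  have g1: "g1 y = c + a - y" if "c < y" "y < a" for y using that by (simp add: g1_def refl_on_ivl_def)
  have g3: "g3 w = a - (a - w) * s" if "e < w" "w < a" for w
  proof (cases "b = 0")
    case True
    then show ?thesis using e0' e by (simp add: g3_def s_def)
  next
    case False
    then show ?thesis using e0 ab that unfolding g3_def s_def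
      by (simp only: if_False) (intro two_piece_right, auto)
  qed
  have sb: "(a - e) * s = a - b" using e by (simp add: s_def)
  have g3_range: "b < a - (a - w) * s" "a - (a - w) * s < a" if "e < w" "w < a" for w
  proof -
    have "(a - w) * s < (a - e) * s" using s that by simp
    then show "b < a - (a - w) * s" using sb by simp
    have "0 < (a - w) * s" by (rule mult_pos_pos) (use s that in auto)
    then show "a - (a - w) * s < a" by simp
  qed
  have g1f: "g1 (f x) = c + a - f x" "e < g1 (f x)" "g1 (f x) < a" if "b < x" "x < a" for x
    using fcd[OF that] g1[of "f x"] da by (auto simp: e_def)
  have g21f: "e < g2 (g1 (f x)) \<and> g2 (g1 (f x)) < a" if "b < x" "x < a" for x
    using g1f[OF that] by (auto simp: g2_def refl_on_ivl_def)
  have mono12: "g2 (g1 (f x)) < g2 (g1 (f y))" if xy: "b < x" "x < y" "y < a" for x y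
  proof (cases "strict_mono_on {b<..<a} f")
    case True
    then have "f x < f y" using xy by (auto simp: strict_mono_on_def)
    then show ?thesis using True g1f[of x] g1f[of y] xy by (auto simp: g2_def refl_on_ivl_def)
  next
    case False
    have "is_interval {b<..<a}" by (simp add: is_interval_1)
    moreover have "inj_on f {b<..<a}" using inj by (rule inj_on_subset) simp
    ultimately have "monotone_on {b<..<a} (<) (>) f"
      using injective_eq_monotone_map[of "{b<..<a}" f] cf False by blast
    then have "f y < f x" using xy by (auto simp: monotone_on_def)
    then show ?thesis using False g1f[of x] g1f[of y] xy by (auto simp: g2_def)
  qed
  define g where "g = g3 \<circ> (g2 \<circ> g1)"
  have gf: "(g \<circ> f) x = a - (a - g2 (g1 (f x))) * s" if "b < x" "x < a" for x
    using g3 g21f[OF that] by (simp add: g_def)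
  show thesis
  proof
    have "g1 \<in> N" unfolding g1_def using c0 cd da ab by (intro refl_N) auto
    moreover have "g2 \<in> N" unfolding g2_def using c0 e ab by (auto intro!: refl_N id_N)
    moreover have "g3 \<in> N" unfolding g3_def using ab e e0 by (auto intro!: two_piece_N id_N)
    ultimately show "g \<in> N" unfolding g_def by (intro N_comp)
    show "strict_mono_on {b<..<a} (g \<circ> f)"
      using gf mono12 s by (auto simp: strict_mono_on_def)
    show "(g \<circ> f) ` {b<..<a} = {b<..<a}"
    proof (intro equalityI subsetI)
      fix z assume "z \<in> (g \<circ> f) ` {b<..<a}"
      then obtain x where x: "b < x" "x < a" "z = (g \<circ> f) x" by auto
      then show "z \<in> {b<..<a}" using gf[OF x(1,2)] g3_range g21f[OF x(1,2)] by simp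
    next
      fix z assume z: "z \<in> {b<..<a}"
      define w where "w = a - (a - z) / s"
      have "(a - z) / s < a - e" using z s sb by (simp add: divide_less_eq)
      moreover have "(a - z) / s > 0" using z s by simp
      ultimately have w: "e < w" "w < a" by (simp_all add: w_def)
      define w' where "w' = g2 w"
      have w': "e < w'" "w' < a" "g2 w' = w" using w by (auto simp: w'_def g2_def refl_on_ivl_def)
      have y: "c < c + a - w'" "c + a - w' < d" using w' by (auto simp: e_def)
      then obtain x where x: "b < x" "x < a" "c + a - w' = f x" using cdf by blast
      have "g1 (f x) = w'" using g1f(1)[OF x(1,2)] x(3) by simp
      then have "(g \<circ> f) x = a - (a - w) * s" using gf[OF x(1,2)] w' by simp
      also have "\<dots> = z" using s by (simp add: w_def)
      finally show "z \<in> (g \<circ> f) ` {b<..<a}" using x by (intro image_eqI[of _ _ x]) auto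
    qed
    have P2: "P g2 z" if "z \<noteq> e" "z \<noteq> a" for z
      using that P_refl P_id_near[of id z] by (simp add: g2_def)
    have P3: "P g3 z" if "z \<noteq> 0" "z \<noteq> e" "z \<noteq> a" for z
      using that P_two_piece[of z e a b] P_id_near[of id z] e e0 ab by (auto simp: g3_def)
    have Pg: "P (g \<circ> f) x" if "P f x" "f x \<noteq> c" "f x \<noteq> a" "g1 (f x) \<noteq> e" "g1 (f x) \<noteq> a"
      "g2 (g1 (f x)) \<noteq> 0" "g2 (g1 (f x)) \<noteq> e" "g2 (g1 (f x)) \<noteq> a" for x
      unfolding g_def using that P2 P3 by (intro comp) (auto simp: g1_def intro: P_refl)
    show "P (g \<circ> f) x" if "x \<in> {b<..<a}" for x
      by (rule Pg) (use that Pf fcd[of x] da g1f[of x] g21f[of x] c0 e in auto)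
    show "P (g \<circ> f) x" if x: "x \<in> {0<..<b}" and ev: "eventually (P f) (nhds x)" for x
    proof -
      have "eventually (\<lambda>z. z \<in> {0<..<b}) (nhds x)" using x by (intro eventually_nhds_in_open) auto
      then have "eventually (\<lambda>z. P f z \<and> z \<in> {0<..<b}) (nhds x)" using ev by eventually_elim auto
      then obtain \<delta> where \<delta>: "\<delta> > 0" "\<And>z. dist z x < \<delta> \<Longrightarrow> P f z \<and> z \<in> {0<..<b}"
        unfolding eventually_nhds_metric by blast
      \<comment> \<open>Near \<open>x\<close> the map \<open>f\<close> is continuous and injective,
        hence open, so all values close to \<open>f x\<close> are taken on \<open>]0, b[\<close>.
        This keeps \<open>f x\<close> strictly between 0 and \<open>a\<close> and off
        \<open>[c, d]\<close>, and then \<open>g1 (f x)\<close> lies in \<open>]0, e[\<close>, away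
        from the break points of \<open>g2\<close> and \<open>g3\<close>.\<close>
      define U where "U = f ` {x - \<delta><..<x + \<delta>}"
      have near: "P f z \<and> z \<in> {0<..<b}" if "z \<in> {x - \<delta><..<x + \<delta>}" for z
        using that by (intro \<delta>(2)) (auto simp: dist_real_def abs_if)
      have "open U" unfolding U_def
        using near by (intro open_injective_image inj P_continuous_on) auto
      moreover have "f x \<in> U" using \<delta> by (auto simp: U_def)
      ultimately obtain \<epsilon> where \<epsilon>: "\<epsilon> > 0" "\<And>y. dist y (f x) < \<epsilon> \<Longrightarrow> y \<in> U"
        unfolding open_dist by blast
      have \<epsilon>': "\<exists>z. 0 < z \<and> z < b \<and> y = f z" if "f x - \<epsilon> < y" "y < f x + \<epsilon>" for y
      proof -
        have "y \<in> U" using that by (intro \<epsilon>(2)) (auto simp: dist_real_def abs_if)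
        then obtain z where z: "z \<in> {x - \<delta><..<x + \<delta>}" "y = f z" unfolding U_def by blast
        then show ?thesis using near[OF z(1)] by auto
      qed
      have b0: "b > 0" using x by auto
      have y0: "0 < f x"
      proof (rule ccontr)
        assume "\<not> 0 < f x"
        then obtain z where "0 < z" "z < b" "f x - \<epsilon> / 2 = f z" using \<epsilon>'[of "f x - \<epsilon> / 2"] \<epsilon>(1) by auto
        then show False using range[of z] ab \<epsilon>(1) \<open>\<not> 0 < f x\<close> by auto
      qed
      have ya: "f x < a"
      proof (rule ccontr)
        assume "\<not> f x < a"
        have "{f x<..<f x + \<epsilon>} \<subseteq> E"
        proof
          fix y assume y: "y \<in> {f x<..<f x + \<epsilon>}"
          then obtain z where z: "0 < z" "z < b" "y = f z" using \<epsilon>'[of y] \<epsilon>(1) by auto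
          then show "y \<in> E" using f_gt[of z] range[of z] y ab \<open>\<not> f x < a\<close> by auto
        qed
        then have "finite {f x<..<f x + \<epsilon>}" using E by (rule finite_subset)
        then show False using infinite_Ioo[of "f x" "f x + \<epsilon>"] \<epsilon>(1) by (metis less_add_same_cancel1)
      qed
      have ycd: "f x < c \<or> d < f x"
      proof (rule ccontr)
        assume *: "\<not> (f x < c \<or> d < f x)"
        then have "max c (f x - \<epsilon>) < min d (f x + \<epsilon>)" using cd \<epsilon>(1) by auto
        then obtain y where y: "max c (f x - \<epsilon>) < y" "y < min d (f x + \<epsilon>)" using dense by blast
        obtain z where z: "0 < z" "z < b" "y = f z" using \<epsilon>'[of y] y by auto
        obtain z' where z': "b < z'" "z' < a" "y = f z'" using cdf[of y] y by auto
        show False using injD[OF inj, of z z'] z z' by simp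
      qed
      have w: "0 < g1 (f x)" "g1 (f x) < e"
        using ycd y0 ya c0 cd(1) e da by (auto simp: g1_def refl_on_ivl_def e_def)
      then have "g2 (g1 (f x)) = g1 (f x)" by (auto simp: g2_def refl_on_ivl_def)
      then show ?thesis using w ycd ya cd(1) e eventually_nhds_x_imp_x[OF ev] by (intro Pg) auto
    qed
    show "(g \<circ> f) x = x" if "x > a" "f x = x" for x
      using that by (simp add: g_def g1_def g2_def g3_def refl_on_ivl_def two_piece_outside)
  qed
qed

end

text \<open>Isolates the step in which the two groups differ. The length condition
  \<open>a - b < 1\<close> leaves room to conjugate the support into \<open>]1/4, 1/2[\<close> in
  the continuous case.\<close>

locale noncentral_normal_base = noncentral_normal +
  assumes increasing_N: "u \<in> G \<Longrightarrow> 0 \<le> b \<Longrightarrow> b < a \<Longrightarrow> a \<le> 1 \<Longrightarrow> a - b < 1 \<Longrightarrow>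
    (\<And>x. x \<notin> {b<..<a} \<Longrightarrow> u x = x) \<Longrightarrow> strict_mono_on {b<..<a} u \<Longrightarrow>
    (\<And>x. x \<in> {b<..<a} \<Longrightarrow> P u x) \<Longrightarrow> u \<in> N"
begin

text \<open>Take \<open>g\<close> from \<open>return_last_piece\<close> and let \<open>u\<close> be
  \<open>g \<circ> f\<close> on the piece and the identity elsewhere. Both lie in \<open>N\<close>,
  and \<open>f' = inv u \<circ> g \<circ> f\<close> is the identity on the piece. To the left of
  \<open>b\<close> it equals \<open>g \<circ> f\<close>, so no break points arise there.\<close>

lemma remove_last_piece:
  assumes fG: "f \<in> G" and ab: "0 \<le> b" "b < a" "a \<le> 1" "a - b < 1"
    and Pf: "\<And>x. x \<in> {b<..<a} \<Longrightarrow> P f x"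
    and fin: "finite {x \<in> {a<..<1}. f x \<noteq> x}"
  obtains f' where "f' \<in> G" "f' \<in> N \<Longrightarrow> f \<in> N" "finite {x \<in> {b<..<1}. f' x \<noteq> x}"
    "\<And>x. x \<in> {0<..<b} \<Longrightarrow> eventually (P f) (nhds x) \<Longrightarrow> eventually (P f') (nhds x)"
proof -
  obtain g where g: "g \<in> N" "(g \<circ> f) ` {b<..<a} = {b<..<a}" "strict_mono_on {b<..<a} (g \<circ> f)"
    "\<And>x. x \<in> {b<..<a} \<Longrightarrow> P (g \<circ> f) x"
    "\<And>x. x \<in> {0<..<b} \<Longrightarrow> eventually (P f) (nhds x) \<Longrightarrow> P (g \<circ> f) x"
    "\<And>x. x > a \<Longrightarrow> f x = x \<Longrightarrow> (g \<circ> f) x = x"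
    by (rule return_last_piece[OF fG ab(1-3) Pf fin]) (assumption | blast)+
  define F where "F = g \<circ> f"
  have gG: "g \<in> G" using g N_sub by blast
  have FG: "F \<in> G" unfolding F_def using fG gG by (rule G_comp)
  have injF: "inj F" using FG by (simp add: G_bij bij_is_inj)
  have F_out: "F x \<notin> {b<..<a}" if "x \<notin> {b<..<a}" for x
  proof
    assume "F x \<in> {b<..<a}"
    then obtain y where "y \<in> {b<..<a}" "F x = F y" using g(2) unfolding F_def by (metis imageE)
    then show False using that injD[OF injF] by metis
  qed
  define u where "u x = (if x \<in> {b<..<a} then F x else x)" for x
  have bu: "bij u"
  proof -
    have 1: "bij_betw u {b<..<a} {b<..<a}"
    proof -
      have "u ` {b<..<a} = F ` {b<..<a}" by (intro image_cong) (auto simp: u_def)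
      moreover have "inj_on u {b<..<a}" by (auto simp: inj_on_def u_def dest: injD[OF injF])
      ultimately show ?thesis using g(2) by (simp only: bij_betw_def F_def)
    qed
    have 2: "bij_betw u (- {b<..<a}) (- {b<..<a})"
      by (auto simp: bij_betw_def u_def inj_on_def)
    show ?thesis using bij_betw_combine[OF 1 2] by simp
  qed
  have Pu: "P u x" if "x \<noteq> a" "x \<noteq> b" for x
  proof (cases "x \<in> {b<..<a}")
    case True
    then have "eventually (\<lambda>z. z \<in> {b<..<a}) (nhds x)" by (intro eventually_nhds_in_open) auto
    then have "eventually (\<lambda>z. F z = u z) (nhds x)" by eventually_elim (simp add: u_def)
    then show ?thesis by (rule cong) (simp only: F_def g(4)[OF True])
  next
    case False
    then have "eventually (\<lambda>z. z \<in> - {b..a}) (nhds x)" using that by (intro eventually_nhds_in_open) auto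
    then show ?thesis by (intro P_id_near) (auto elim!: eventually_mono simp: u_def)
  qed
  have uG: "u \<in> G"
  proof (rule G_I[where T = "{a, b}"])
    show "perm_X u" using bu ab by (auto simp: perm_X_iff u_def Xint_def)
  qed (auto intro: Pu)
  have "strict_mono_on {b<..<a} u"
    using g(3) by (simp add: strict_mono_on_def u_def F_def)
  then have uN: "u \<in> N" using uG ab Pu by (intro increasing_N[of u b a]) (auto simp: u_def)
  define f' where "f' = inv u \<circ> F"
  have f'G: "f' \<in> G" unfolding f'_def using FG uG by (intro G_comp G_inv)
  have f'_in: "f' x = x" if "x \<in> {b<..<a}" for x
  proof -
    have "F x = u x" using that by (simp add: u_def)
    then show ?thesis using uG by (simp add: f'_def G_inverse_simps)
  qed
  have f'_out: "f' x = F x" if "x \<notin> {b<..<a}" for x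
  proof -
    have "F x = u (F x)" using F_out[OF that] by (auto simp: u_def)
    then have "inv u (F x) = inv u (u (F x))" by (rule arg_cong)
    then show ?thesis using uG by (simp only: f'_def comp_apply G_inverse_simps(1))
  qed
  show thesis
  proof
    show "f' \<in> G" by (rule f'G)
    show "f \<in> N" if "f' \<in> N"
    proof -
      have "inv g \<circ> (u \<circ> f') \<in> N" using that uN g(1) by (intro N_comp N_inv)
      moreover have "inv g \<circ> (u \<circ> f') = f"
        using uG gG by (auto simp: fun_eq_iff f'_def F_def G_inverse_simps)
      ultimately show ?thesis by simp
    qed
    show "finite {x \<in> {b<..<1}. f' x \<noteq> x}"
    proof (rule finite_subset)
      show "{x \<in> {b<..<1}. f' x \<noteq> x} \<subseteq> insert a {x \<in> {a<..<1}. f x \<noteq> x}"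
        using f'_in f'_out g(6) by (force simp: F_def)
    qed (use fin in simp)
    show "eventually (P f') (nhds x)" if x: "x \<in> {0<..<b}" and ev: "eventually (P f) (nhds x)" for x
    proof -
      have "eventually (\<lambda>z. z \<in> {0<..<b}) (nhds x)" using x by (intro eventually_nhds_in_open) auto
      moreover have "eventually (\<lambda>z. eventually (P f) (nhds z)) (nhds x)"
        using ev by (simp add: eventually_eventually)
      ultimately show ?thesis
      proof eventually_elim
        case (elim z)
        then have "P F z" unfolding F_def by (intro g(5))
        moreover have "eventually (\<lambda>y. F y = f' y) (nhds z)"
          using eventually_nhds_in_open[of "{..<b}" z] elim
          by (auto elim!: eventually_mono simp: f'_out)
        ultimately show ?case using cong by blast
      qed
    qed
  qed
qed

section \<open>Induction on the break points\<close>

lemma N_if_finite_support: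
  assumes "f \<in> G" "finite {x \<in> {0<..<1}. f x \<noteq> x}" shows "f \<in> N"
proof -
  have "{x. f x \<noteq> x} \<subseteq> insert 0 {x \<in> {0<..<1}. f x \<noteq> x}"
  proof
    fix x assume x: "x \<in> {x. f x \<noteq> x}"
    then have "x \<in> Xint" using G_perm[OF assms(1)] by (auto simp: perm_X_iff)
    then show "x \<in> insert 0 {x \<in> {0<..<1}. f x \<noteq> x}" using x by (auto simp: Xint_def)
  qed
  then have "finite {x. f x \<noteq> x}" by (rule finite_subset) (use assms in simp)
  then show ?thesis using assms G_perm Sfin_sub by (auto simp: Sfin_def)
qed

text \<open>The map is already trivial to the right of \<open>a\<close>, up to finitely many points.
  Removing the piece between the largest break point below \<open>a\<close> and \<open>a\<close>
  lowers the number of break points. The last hypothesis keeps every removed piece shorter than 1: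
  after the first round \<open>a < 1\<close>, and in the first round 1/2 may serve as a break
  point.\<close>

lemma N_if_finitely_many_pieces:
  assumes "finite S" "f \<in> G" "0 \<le> a" "a \<le> 1" "finite {x \<in> {a<..<1}. f x \<noteq> x}"
    "\<And>x. x \<in> {0<..<a} - S \<Longrightarrow> P f x" "a < 1 \<or> 1 / 2 \<in> S"
  shows "f \<in> N"
  using assms
proof (induction "card S" arbitrary: S f a rule: less_induct)
  case less
  note fin = less.prems(1) and ev = less.prems(6)
  show ?case
  proof (cases "a = 0")
    case True
    then show ?thesis using less.prems by (intro N_if_finite_support) auto
  next
    case False
    then have a: "a > 0" using less.prems by simp
    \<comment> \<open>Including 0 makes \<open>b\<close> the left end of the last piece also when no
      break point is left below \<open>a\<close>.\<close>
    define B where "B = insert 0 (S \<inter> {0<..<a})"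
    define b where "b = Max B"
    have B: "finite B" "B \<noteq> {}" using fin by (auto simp: B_def)
    have bB: "b \<in> B" unfolding b_def using B by (rule Max_in)
    have bmax: "x \<le> b" if "x \<in> B" for x unfolding b_def using B that by simp
    have b: "0 \<le> b" "b < a" using bB bmax a by (auto simp: B_def)
    have gap: "a - b < 1"
    proof (cases "a < 1")
      case False
      then have "1 / 2 \<in> B" using less.prems by (auto simp: B_def)
      then show ?thesis using bmax less.prems by fastforce
    qed (use b in auto)
    have Pf: "P f x" if "x \<in> {b<..<a}" for x
      using that bmax[of x] b by (intro ev) (auto simp: B_def)
    obtain f' where f': "f' \<in> G" "f' \<in> N \<Longrightarrow> f \<in> N" "finite {x \<in> {b<..<1}. f' x \<noteq> x}"
      "\<And>x. x \<in> {0<..<b} \<Longrightarrow> eventually (P f) (nhds x) \<Longrightarrow> eventually (P f') (nhds x)"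
      by (rule remove_last_piece[OF less.prems(2) b less.prems(4) gap Pf less.prems(5)])
        (assumption | blast)+
    show ?thesis
    proof (cases "b = 0")
      case True
      then show ?thesis using f' N_if_finite_support by simp
    next
      case False
      then have bS: "b \<in> S" using bB by (auto simp: B_def)
      have "f' \<in> N"
      proof (rule less.hyps[of "S - {b}"])
        show "card (S - {b}) < card S" using fin bS by (rule card_Diff1_less)
        show "P f' x" if x: "x \<in> {0<..<b} - (S - {b})" for x
        proof -
          have "eventually (\<lambda>z. z \<notin> S) (nhds x)" using x fin by (intro eventually_avoid_finite) auto
          moreover have "eventually (\<lambda>z. z \<in> {0<..<a}) (nhds x)"
            using x b by (intro eventually_nhds_in_open) auto
          ultimately have "eventually (P f) (nhds x)" by eventually_elim (auto intro: ev)
          then show ?thesis using f'(4)[of x] x eventually_nhds_x_imp_x by fastforce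
        qed
      qed (use f' b less.prems in auto)
      then show ?thesis by (rule f'(2))
    qed
  qed
qed

theorem N_eq_G: "N = G"
proof (intro equalityI subsetI)
  fix f assume f: "f \<in> G"
  show "f \<in> N"
  proof (rule N_if_finitely_many_pieces[where a = 1])
    \<comment> \<open>The artificial break point 1/2 ensures that even a map without break points is
      cut into pieces shorter than 1.\<close>
    show "finite (insert (1 / 2) {x \<in> {0<..<1}. \<not> P f x})" using G_D[OF f] by simp
    show "f \<in> G" by (rule f)
  qed auto
qed (use N_sub in auto)

end

subsection \<open>The piecewise affine group\<close>

definition affine_near :: "(real \<Rightarrow> real) \<Rightarrow> real \<Rightarrow> bool" where
  "affine_near f x \<longleftrightarrow> (\<exists>\<alpha> \<beta>. eventually (\<lambda>y. f y = \<alpha> * y + \<beta>) (nhds x))"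

lemma affine_near_isCont: assumes "affine_near f x" shows "isCont f x"
proof -
  obtain \<alpha> \<beta> where "eventually (\<lambda>y. f y = \<alpha> * y + \<beta>) (nhds x)"
    using assms by (auto simp: affine_near_def)
  then have "isCont f x \<longleftrightarrow> isCont (\<lambda>y. \<alpha> * y + \<beta>) x" by (rule isCont_cong)
  then show ?thesis by simp
qed

lemma affine_near_comp:
  assumes "affine_near f x" "affine_near g (f x)" shows "affine_near (g \<circ> f) x"
proof -
  obtain \<alpha> \<beta> where f: "eventually (\<lambda>y. f y = \<alpha> * y + \<beta>) (nhds x)"
    using assms by (auto simp: affine_near_def)
  obtain \<gamma> \<delta> where g: "eventually (\<lambda>y. g y = \<gamma> * y + \<delta>) (nhds (f x))"
    using assms by (auto simp: affine_near_def)
  have "filterlim f (nhds (f x)) (nhds x)"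
    using affine_near_isCont[OF assms(1)] by (simp add: isCont_def tendsto_at_iff_tendsto_nhds)
  then have "eventually (\<lambda>y. g (f y) = \<gamma> * f y + \<delta>) (nhds x)"
    using g by (rule eventually_compose_filterlim[rotated])
  then have "eventually (\<lambda>y. (g \<circ> f) y = (\<gamma> * \<alpha>) * y + (\<gamma> * \<beta> + \<delta>)) (nhds x)"
    using f by eventually_elim (simp add: algebra_simps)
  then show ?thesis unfolding affine_near_def by blast
qed

lemma affine_near_inverse:
  assumes "bij f" "affine_near f x" shows "affine_near (inv f) (f x)"
proof -
  obtain \<alpha> \<beta> where f: "eventually (\<lambda>y. f y = \<alpha> * y + \<beta>) (nhds x)"
    using assms by (auto simp: affine_near_def)
  then obtain e where e: "e > 0" "\<And>y. dist y x < e \<Longrightarrow> f y = \<alpha> * y + \<beta>"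
    unfolding eventually_nhds_metric by blast
  have fx: "f x = \<alpha> * x + \<beta>" using e by simp
  have "\<alpha> \<noteq> 0"
  proof
    assume "\<alpha> = 0"
    then have "f x = f (x + e / 2)" using e by (simp add: dist_real_def)
    then show False using injD[OF bij_is_inj[OF assms(1)]] e(1) by fastforce
  qed
  have "isCont (\<lambda>z. (z - \<beta>) / \<alpha>) (f x)" using \<open>\<alpha> \<noteq> 0\<close> by (intro continuous_intros)
  then have "((\<lambda>z. (z - \<beta>) / \<alpha>) \<longlongrightarrow> (f x - \<beta>) / \<alpha>) (nhds (f x))"
    using tendsto_at_iff_tendsto_nhds[of "\<lambda>z. (z - \<beta>) / \<alpha>" "f x"] unfolding isCont_def by blast
  moreover have "(f x - \<beta>) / \<alpha> = x" using fx \<open>\<alpha> \<noteq> 0\<close> by simp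
  ultimately have "filterlim (\<lambda>z. (z - \<beta>) / \<alpha>) (nhds x) (nhds (f x))" by (simp only:)
  with f have "eventually (\<lambda>z. f ((z - \<beta>) / \<alpha>) = \<alpha> * ((z - \<beta>) / \<alpha>) + \<beta>) (nhds (f x))"
    by (rule eventually_compose_filterlim)
  then have "eventually (\<lambda>z. inv f z = (1 / \<alpha>) * z + (- \<beta> / \<alpha>)) (nhds (f x))"
  proof eventually_elim
    case (elim z)
    then have "f ((z - \<beta>) / \<alpha>) = z" using \<open>\<alpha> \<noteq> 0\<close> by simp
    then have "inv f z = (z - \<beta>) / \<alpha>" using assms(1) by (metis bij_is_inj inv_f_f)
    then show ?case by (simp add: diff_divide_distrib)
  qed
  then show ?thesis unfolding affine_near_def by blast
qed

text \<open>The coefficients of an affine germ are unique, so they form a locally constant function,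
  which is constant on the connected interval.\<close>

lemma affine_near_interval:
  assumes "u < v" "\<And>x. x \<in> {u<..<v} \<Longrightarrow> affine_near f x"
  obtains \<alpha> \<beta> where "\<And>x. x \<in> {u<..<v} \<Longrightarrow> f x = \<alpha> * x + \<beta>"
proof -
  define coeffs where "coeffs x = (THE c. eventually (\<lambda>y. f y = fst c * y + snd c) (nhds x))" for x
  have coeffs: "coeffs x = (\<alpha>, \<beta>)" if ev: "eventually (\<lambda>y. f y = \<alpha> * y + \<beta>) (nhds x)" for x \<alpha> \<beta>
    unfolding coeffs_def
  proof (rule the_equality)
    fix c assume "eventually (\<lambda>y. f y = fst c * y + snd c) (nhds x)"
    then have "eventually (\<lambda>y. fst c * y + snd c = \<alpha> * y + \<beta>) (nhds x)" using ev by eventually_elim simp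
    then obtain e where e: "e > 0" "\<And>y. dist y x < e \<Longrightarrow> fst c * y + snd c = \<alpha> * y + \<beta>"
      unfolding eventually_nhds_metric by blast
    have 1: "fst c * x + snd c = \<alpha> * x + \<beta>" using e by simp
    have "fst c * (x + e / 2) + snd c = \<alpha> * (x + e / 2) + \<beta>" using e by (simp add: dist_real_def)
    then have "fst c * (e / 2) = \<alpha> * (e / 2)" using 1 unfolding distrib_left by linarith
    then have "fst c = \<alpha>" using e(1) by simp
    then show "c = (\<alpha>, \<beta>)" using 1 by (simp add: prod_eq_iff)
  qed (use ev in simp)
  have val: "f x = fst (coeffs x) * x + snd (coeffs x)"
    and loc: "eventually (\<lambda>y. coeffs x = coeffs y) (nhds x)" if x: "x \<in> {u<..<v}" for x
  proof -
    obtain \<alpha> \<beta> where ev: "eventually (\<lambda>y. f y = \<alpha> * y + \<beta>) (nhds x)"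
      using assms(2)[OF x] by (auto simp: affine_near_def)
    then show "f x = fst (coeffs x) * x + snd (coeffs x)"
      using coeffs[OF ev] eventually_nhds_x_imp_x[OF ev] by simp
    have "eventually (\<lambda>z. eventually (\<lambda>y. f y = \<alpha> * y + \<beta>) (nhds z)) (nhds x)"
      using ev by (simp add: eventually_eventually)
    then show "eventually (\<lambda>y. coeffs x = coeffs y) (nhds x)"
      by eventually_elim (simp add: coeffs coeffs[OF ev])
  qed
  define m where "m = (u + v) / 2"
  have m: "m \<in> {u<..<v}" using assms(1) by (simp add: m_def)
  have "coeffs m = coeffs x" if "x \<in> {u<..<v}" for x
    using m that
    by (rule connected_local_const[rotated]) (auto intro!: eventually_at_filter[THEN iffD2] eventually_mono[OF loc])
  then show thesis using val that[of "fst (coeffs m)" "snd (coeffs m)"] by metis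
qed

interpretation aff: local_regularity affine_near
proof
  show "affine_near f x" if "eventually (\<lambda>y. f y = \<alpha> * y + \<beta>) (nhds x)" for f \<alpha> \<beta> x
    using that unfolding affine_near_def by blast
  show "affine_near g x" if fg: "eventually (\<lambda>y. f y = g y) (nhds x)" and f: "affine_near f x" for f g x
  proof -
    obtain \<alpha> \<beta> where "eventually (\<lambda>y. f y = \<alpha> * y + \<beta>) (nhds x)"
      using f by (auto simp: affine_near_def)
    then have "eventually (\<lambda>y. g y = \<alpha> * y + \<beta>) (nhds x)" using fg by eventually_elim simp
    then show ?thesis unfolding affine_near_def by blast
  qed
  show "affine_near (inv f) (f x)" if "bij f" "eventually (affine_near f) (nhds x)" for f x
    using that eventually_nhds_x_imp_x affine_near_inverse by blast
qed (auto intro: affine_near_comp affine_near_isCont)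

text \<open>From right to left, the partition is the increasing enumeration of 0, 1 and the points
  of \<open>]0, 1[\<close> where \<open>f\<close> is not locally affine; on each gap local affinity
  becomes global.\<close>

lemma hatPAff_eq: "hatPAff = aff.G"
proof (intro equalityI subsetI)
  fix f assume "f \<in> hatPAff"
  then obtain n :: nat and t where pf: "perm_X f" and t: "n \<ge> 1" "t 0 = 0" "t n = 1" "\<And>i. i < n \<Longrightarrow> t i < t (Suc i)"
    and aff: "\<And>i. i < n \<Longrightarrow> \<exists>a b. \<forall>x \<in> {t i<..<t (Suc i)}. f x = a * x + b"
    unfolding hatPAff_def by blast
  show "f \<in> aff.G"
  proof (rule aff.G_I[OF pf, of "t ` {..n}"])
    fix x :: real assume x: "0 < x" "x < 1" "x \<notin> t ` {..n}"
    \<comment> \<open>The first partition point beyond \<open>x\<close> and its predecessor enclose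
      \<open>x\<close>.\<close>
    define i where "i = (LEAST j. x < t j)"
    have xi: "x < t i" unfolding i_def by (rule LeastI[of _ n]) (use x t in simp)
    have "i \<le> n" unfolding i_def by (rule Least_le) (use x t in simp)
    have "i \<noteq> 0" using xi x t by (metis less_asym)
    then obtain j where j: "i = Suc j" by (cases i) auto
    have "\<not> x < t j" using not_less_Least[of j "\<lambda>j. x < t j"] j by (simp add: i_def)
    moreover have "t j \<noteq> x" using x j \<open>i \<le> n\<close> by auto
    ultimately have xj: "x \<in> {t j<..<t (Suc j)}" using xi j by auto
    obtain a b where ab: "\<forall>x \<in> {t j<..<t (Suc j)}. f x = a * x + b" using aff[of j] j \<open>i \<le> n\<close> by auto
    have "eventually (\<lambda>y. y \<in> {t j<..<t (Suc j)}) (nhds x)" using xj by (intro eventually_nhds_in_open) auto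
    then have "eventually (\<lambda>y. f y = a * y + b) (nhds x)" by eventually_elim (use ab in blast)
    then show "affine_near f x" unfolding affine_near_def by blast
  qed simp
next
  fix f assume f: "f \<in> aff.G"
  define S where "S = {0, 1} \<union> {x \<in> {0<..<1}. \<not> affine_near f x}"
  have S: "finite S" "S \<subseteq> {0..1}" "0 \<in> S" "1 \<in> S" using aff.G_D[OF f] by (auto simp: S_def)
  define l where "l = sorted_list_of_set S"
  have l: "set l = S" "sorted_wrt (<) l" "length l = card S" using S by (simp_all add: l_def)
  have card: "card S \<ge> 2" using card_mono[of S "{0, 1}"] S by simp
  define n where "n = card S - 1"
  have n: "n \<ge> 1" "length l = Suc n" using card l by (auto simp: n_def)
  have ord: "l ! i < l ! j \<longleftrightarrow> i < j" if "i \<le> n" "j \<le> n" for i j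
    using that l(2) n by (metis less_Suc_eq_le linorder_neqE_nat order_less_asym sorted_wrt_nth_less)
  have ex: "\<exists>i \<le> n. x = l ! i" if "x \<in> S" for x
    using that l(1) n by (metis in_set_conv_nth less_Suc_eq_le)
  have mem: "l ! i \<in> S" if "i \<le> n" for i using that l(1) n by (metis less_Suc_eq_le nth_mem)
  have l0: "l ! 0 = 0"
  proof -
    obtain i where i: "i \<le> n" "l ! i = 0" using ex[OF S(3)] by metis
    have "\<not> l ! 0 < 0" using mem[of 0] S by fastforce
    then show ?thesis using ord[of 0 i] i by (cases i) auto
  qed
  have ln: "l ! n = 1"
  proof -
    obtain i where i: "i \<le> n" "l ! i = 1" using ex[OF S(4)] by metis
    have "\<not> 1 < l ! n" using mem[of n] S by fastforce
    then show ?thesis using ord[of i n] i by (metis le_neq_implies_less order_refl)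
  qed
  have "\<exists>a b. \<forall>x \<in> {l ! i<..<l ! Suc i}. f x = a * x + b" if i: "i < n" for i
  proof -
    have lt: "l ! i < l ! Suc i" using ord[of i "Suc i"] i by simp
    have "affine_near f x" if x: "x \<in> {l ! i<..<l ! Suc i}" for x
    proof -
      have "x \<notin> S"
      proof
        assume "x \<in> S"
        then obtain j where "j \<le> n" "x = l ! j" using ex by blast
        then show False using x ord[of i j] ord[of j "Suc i"] i by auto
      qed
      moreover have "0 < x" "x < 1" using x mem[of i] mem[of "Suc i"] S(2) i by fastforce+
      ultimately show ?thesis by (auto simp: S_def)
    qed
    then show ?thesis using affine_near_interval[OF lt] by metis
  qed
  then show "f \<in> hatPAff"
    unfolding hatPAff_def using aff.G_perm[OF f] n l0 ln ord
    by (intro CollectI conjI exI[of _ n] exI[of _ "\<lambda>i. l ! i"]) auto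
qed

section \<open>Increasing affine self-maps of an interval\<close>

lemma bij_fixing_complement_maps:
  assumes "bij w" "\<And>x. x \<notin> S \<Longrightarrow> w x = x" "x \<in> S" shows "w x \<in> S"
  using assms by (metis bij_is_inj injD)

text \<open>By continuity the affine map and its inverse send the closed interval into itself. Being
  increasing, they fix both end points, which determines an affine map.\<close>

lemma increasing_affine_self_map_eq_id:
  fixes \<alpha> \<beta> :: real
  assumes "b < a" "\<alpha> > 0" "bij u" and out: "\<And>x. x \<notin> {b<..<a} \<Longrightarrow> u x = x"
    and u: "\<And>x. x \<in> {b<..<a} \<Longrightarrow> u x = \<alpha> * x + \<beta>"
  shows "u = id"
proof -
  have maps: "u x \<in> {b<..<a}" if "x \<in> {b<..<a}" for x
    by (rule bij_fixing_complement_maps[OF assms(3) out that])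
  have maps': "inv u x \<in> {b<..<a}" if "x \<in> {b<..<a}" for x
  proof (rule bij_fixing_complement_maps[OF bij_imp_bij_inv[OF assms(3)] _ that])
    show "inv u y = y" if "y \<notin> {b<..<a}" for y
      using out[OF that] assms(3) by (metis bij_is_inj inv_f_f)
  qed
  have cl: "closure {b<..<a} = {b..a}" using assms(1) by simp
  have 1: "(\<lambda>x. \<alpha> * x + \<beta>) ` closure {b<..<a} \<subseteq> {b..a}"
  proof (rule image_closure_subset)
    show "(\<lambda>x. \<alpha> * x + \<beta>) ` {b<..<a} \<subseteq> {b..a}"
    proof
      fix y assume "y \<in> (\<lambda>x. \<alpha> * x + \<beta>) ` {b<..<a}"
      then obtain x where "x \<in> {b<..<a}" "y = u x" using u by auto
      then show "y \<in> {b..a}" using maps[of x] by simp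
    qed
  qed (auto intro!: continuous_intros)
  have 2: "(\<lambda>x. (x - \<beta>) / \<alpha>) ` closure {b<..<a} \<subseteq> {b..a}"
  proof (rule image_closure_subset)
    show "(\<lambda>x. (x - \<beta>) / \<alpha>) ` {b<..<a} \<subseteq> {b..a}"
    proof
      fix y assume "y \<in> (\<lambda>x. (x - \<beta>) / \<alpha>) ` {b<..<a}"
      then obtain x where x: "x \<in> {b<..<a}" "y = (x - \<beta>) / \<alpha>" by auto
      have "x = u (inv u x)" using assms(3) by (simp add: bij_is_surj surj_f_inv_f)
      then have "x = \<alpha> * inv u x + \<beta>" using u[OF maps'[OF x(1)]] by simp
      then have "inv u x = (x - \<beta>) / \<alpha>" using assms(2) by (simp add: field_simps)
      then show "y \<in> {b..a}" using maps'[OF x(1)] x(2) by simp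
    qed
  qed (use assms(2) in \<open>auto intro!: continuous_intros\<close>)
  \<comment> \<open>The map and its inverse give opposite inequalities at each end point.\<close>
  have "\<alpha> * b + \<beta> \<in> {b..a}" "\<alpha> * a + \<beta> \<in> {b..a}" "(b - \<beta>) / \<alpha> \<in> {b..a}" "(a - \<beta>) / \<alpha> \<in> {b..a}"
    using 1 2 assms(1) unfolding cl by (auto simp: image_subset_iff)
  then have eq: "\<alpha> * b + \<beta> = b" "\<alpha> * a + \<beta> = a"
    using assms(2) by (auto simp: field_simps)
  then have "\<alpha> * (a - b) = a - b" by (simp add: algebra_simps)
  then have "\<alpha> = 1" using assms(1) by simp
  then show ?thesis using eq u out by (auto simp: fun_eq_iff)
qed

lemma noncentral_normal_PAff:
  assumes "noncentral_normal affine_near N" shows "N = aff.G"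
proof -
  interpret noncentral_normal affine_near N by fact
  interpret noncentral_normal_base affine_near N
  proof
    fix u and a b :: real
    assume u: "u \<in> aff.G" "\<And>x. x \<notin> {b<..<a} \<Longrightarrow> u x = x" "strict_mono_on {b<..<a} u"
      "\<And>x. x \<in> {b<..<a} \<Longrightarrow> affine_near u x" and ba: "b < a"
    obtain \<alpha> \<beta> where aff: "\<And>x. x \<in> {b<..<a} \<Longrightarrow> u x = \<alpha> * x + \<beta>"
      using affine_near_interval[OF ba u(4)] by metis
    define x y where "x = (2 * b + a) / 3" and "y = (b + 2 * a) / 3"
    have xy: "x \<in> {b<..<a}" "y \<in> {b<..<a}" "x < y" using ba by (auto simp: x_def y_def)
    then have "\<alpha> * x < \<alpha> * y" using u(3) aff by (auto simp: strict_mono_on_def)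
    then have "\<alpha> > 0" using xy(3) by (simp add: mult_less_cancel_left)
    then have "u = id" by (rule increasing_affine_self_map_eq_id[OF ba _ aff.G_bij[OF u(1)] u(2) aff])
    then show "u \<in> N" using id_N by simp
  qed
  show ?thesis by (rule N_eq_G)
qed

subsection \<open>The piecewise continuous group\<close>

interpretation cts: local_regularity "isCont :: (real \<Rightarrow> real) \<Rightarrow> real \<Rightarrow> bool"
proof
  show "isCont f x" if "eventually (\<lambda>y. f y = \<alpha> * y + \<beta>) (nhds x)" for f :: "real \<Rightarrow> real" and \<alpha> \<beta> x
    using isCont_cong[OF that] by simp
  show "isCont g x" if "eventually (\<lambda>y. f y = g y) (nhds x)" "isCont f x" for f g :: "real \<Rightarrow> real" and x
    using isCont_cong[OF that(1)] that(2) by simp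
  show "isCont (g \<circ> f) x" if "isCont f x" "isCont g (f x)" for f g :: "real \<Rightarrow> real" and x
    using that unfolding comp_def by (rule isCont_o2)
  show "isCont (inv f) (f x)" if "bij f" and ev: "eventually (isCont f) (nhds x)" for f :: "real \<Rightarrow> real" and x
  proof -
    obtain e where e: "e > 0" "\<And>y. dist y x < e \<Longrightarrow> isCont f y"
      using ev unfolding eventually_nhds_metric by blast
    show ?thesis
      \<comment> \<open>The rule wants continuity on a closed ball, whence half the radius.\<close>
      by (rule isCont_inverse_function[of "e / 2"])
        (use e that(1) in \<open>auto simp: dist_real_def bij_is_inj\<close>)
  qed
qed

text \<open>Continuity within X and on the line agree at interior points. The end point 0, where
  they may differ, goes into the exceptional set.\<close>

lemma hatPC_eq: "hatPC = cts.G"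
proof -
  have at: "at x within Xint = at x" if "0 < x" "x < 1" for x :: real
    using that by (intro at_within_interior) (simp add: Xint_def)
  show ?thesis
  proof (intro equalityI subsetI)
    fix f assume "f \<in> hatPC"
    then obtain S where "perm_X f" "finite S" "\<And>x. x \<in> Xint - S \<Longrightarrow> continuous (at x within Xint) f"
      unfolding hatPC_def by blast
    note S = this
    have "isCont f x" if "0 < x" "x < 1" "x \<notin> S" for x
      using S(3)[of x] at[of x] that by (simp add: Xint_def)
    then show "f \<in> cts.G" using S by (intro cts.G_I[of f S])
  next
    fix f assume f: "f \<in> cts.G"
    let ?S = "insert 0 {x \<in> {0<..<1}. \<not> isCont f x}"
    have "finite ?S" using cts.G_D[OF f] by simp
    moreover have "continuous (at x within Xint) f" if "x \<in> Xint - ?S" for x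
      using that at[of x] by (auto simp: Xint_def)
    moreover have "?S \<subseteq> Xint" by (auto simp: Xint_def)
    ultimately show "f \<in> hatPC"
      unfolding hatPC_def using cts.G_perm[OF f] by blast
  qed
qed

text \<open>The infinite product of the conjugates of \<open>w\<close>, supported in \<open>]1/4, 1/2[\<close>, by the powers of
  \<open>x \<mapsto> x / 2\<close>.\<close>

function swindle :: "(real \<Rightarrow> real) \<Rightarrow> real \<Rightarrow> real" where
  "swindle w x = (if 0 < x \<and> x < 1 / 4 then swindle w (2 * x) / 2 else w x)"
  by auto
termination
\<comment> \<open>Doubling \<open>x\<close> halves \<open>1 / x\<close>; as
  \<open>1 / x > 4\<close>, this lowers it by more than 1, so its ceiling drops.\<close>
proof (relation "Wellfounded.measure (\<lambda>(w, x). nat \<lceil>1 / x\<rceil>)")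
  fix w :: "real \<Rightarrow> real" and x :: real assume x: "0 < x \<and> x < 1 / 4"
  then have "1 / x > 4" by (simp add: field_simps)
  moreover have "1 / (2 * x) = (1 / x) / 2" by simp
  ultimately have "1 / (2 * x) + 1 \<le> 1 / x" by linarith
  then have "\<lceil>1 / (2 * x)\<rceil> + 1 \<le> \<lceil>1 / x\<rceil>" by (metis ceiling_add_one ceiling_mono)
  moreover have "\<lceil>1 / x\<rceil> > 0" using x by simp
  ultimately show "((w, 2 * x), w, x) \<in> Wellfounded.measure (\<lambda>(w, x). nat \<lceil>1 / x\<rceil>)" by simp
qed simp

declare swindle.simps [simp del]

text \<open>The recursion pattern of \<open>swindle\<close> as an induction rule: a positive
  \<open>x\<close> is doubled until it reaches 1/4, and all other points are base cases.\<close>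

lemma doubling_induct:
  assumes "\<And>x. (0 < x \<Longrightarrow> x < 1 / 4 \<Longrightarrow> Q (2 * x)) \<Longrightarrow> Q x" shows "Q (x :: real)"
  by (rule swindle.induct[of "\<lambda>_. Q" undefined x]) (use assms in blast)

lemma swindle_small: "0 < x \<Longrightarrow> x < 1 / 4 \<Longrightarrow> swindle w x = swindle w (2 * x) / 2"
  by (subst swindle.simps) simp

lemma swindle_large: "x \<le> 0 \<or> 1 / 4 \<le> x \<Longrightarrow> swindle w x = w x"
  by (subst swindle.simps) auto

section \<open>Homeomorphisms supported in a fundamental domain of halving\<close>

lemma strict_mono_fixing_complement:
  fixes w :: "real \<Rightarrow> real"
  assumes "bij w" and out: "\<And>x. x \<notin> {p<..<q} \<Longrightarrow> w x = x" and mono: "strict_mono_on {p<..<q} w"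
  shows "strict_mono w"
proof (rule strict_monoI)
  fix x y :: real assume xy: "x < y"
  have maps: "p < w x \<and> w x < q" if "p < x" "x < q" for x
    using bij_fixing_complement_maps[of w "{p<..<q}" x] assms that by auto
  show "w x < w y"
  proof (cases "x \<in> {p<..<q}"; cases "y \<in> {p<..<q}")
    assume "x \<in> {p<..<q}" "y \<in> {p<..<q}"
    then show ?thesis using mono xy by (auto simp: strict_mono_on_def)
  next
    assume "x \<in> {p<..<q}" "y \<notin> {p<..<q}"
    then show ?thesis using maps[of x] out[of y] xy by auto
  next
    assume "x \<notin> {p<..<q}" "y \<in> {p<..<q}"
    then show ?thesis using maps[of y] out[of x] xy by auto
  qed (use out xy in auto)
qed

text \<open>Every point of \<open>]0, 1/2[\<close> is obtained from exactly one point of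
  \<open>[1/4, 1/2[\<close> by a unique number of halvings. Monotonicity on the whole line is what
  later yields continuity of the infinite product.\<close>

locale fundamental_domain_map =
  fixes w :: "real \<Rightarrow> real"
  assumes bij: "bij w" and out: "\<And>x. x \<notin> {1/4<..<1/2} \<Longrightarrow> w x = x" and mono: "strict_mono w"
begin

lemma inverse: "fundamental_domain_map (inv w)"
proof
  show "bij (inv w)" by (rule bij_imp_bij_inv[OF bij])
  show "inv w x = x" if "x \<notin> {1/4<..<1/2}" for x
    using out[OF that] bij by (metis bij_is_inj inv_f_f)
  have "w (inv w x) = x" for x using bij by (simp add: bij_is_surj surj_f_inv_f)
  then show "strict_mono (inv w)" using strict_mono_less[OF mono] by (metis strict_monoI)
qed

lemma w_fundamental: "1 / 4 \<le> x \<Longrightarrow> x < 1 / 2 \<Longrightarrow> 1 / 4 \<le> w x \<and> w x < 1 / 2"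
  using out[of "1/4"] out[of "1/2"] strict_mono_less[OF mono, of x "1/2"]
    strict_mono_less_eq[OF mono, of "1/4" x] by auto

lemma swindle_range_half: "0 < x \<Longrightarrow> x < 1 / 2 \<Longrightarrow> 0 < swindle w x \<and> swindle w x < 1 / 2"
proof (induction x rule: doubling_induct)
  case (1 x)
  show ?case
  proof (cases "x < 1 / 4")
    case True
    then have "swindle w x = swindle w (2 * x) / 2" using 1 by (intro swindle_small)
    moreover have "0 < swindle w (2 * x) \<and> swindle w (2 * x) < 1 / 2" using 1 True by auto
    ultimately show ?thesis by auto
  next
    case False
    then show ?thesis using w_fundamental[of x] swindle_large[of x w] 1 by auto
  qed
qed

lemma swindle_range_quarter:
  "0 < x \<Longrightarrow> x < 1 / 4 \<Longrightarrow> 0 < swindle w x \<and> swindle w x < 1 / 4"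
  using swindle_range_half[of "2 * x"] swindle_small[of x w] by auto

lemma swindle_range_large:
  assumes "x \<le> 0 \<or> 1 / 4 \<le> x" shows "swindle w x \<le> 0 \<or> 1 / 4 \<le> swindle w x"
proof -
  have "w x \<le> 0 \<or> 1 / 4 \<le> w x" using assms w_fundamental[of x] out[of x] by (cases "x < 1 / 2") auto
  then show ?thesis using swindle_large[OF assms, of w] by simp
qed

text \<open>The factors have disjoint supports, so the infinite product is inverted factor by
  factor.\<close>

lemma swindle_inverse: "swindle (inv w) (swindle w x) = x"
proof (induction x rule: doubling_induct)
  case (1 x)
  show ?case
  proof (cases "0 < x \<and> x < 1 / 4")
    case True
    then have "swindle (inv w) (swindle w x) = swindle (inv w) (2 * swindle w x) / 2"
      using swindle_range_quarter[of x] by (intro swindle_small) auto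
    also have "2 * swindle w x = swindle w (2 * x)" using True swindle_small[of x w] by simp
    finally show ?thesis using 1 True by simp
  next
    case False
    then have x: "x \<le> 0 \<or> 1 / 4 \<le> x" by auto
    then show ?thesis
      using swindle_large[OF x, of w] swindle_large[OF swindle_range_large[OF x], of "inv w"] bij
      by (simp add: bij_is_inj)
  qed
qed

lemma swindle_bij: "bij (swindle w)"
proof (rule o_bij)
  show "swindle (inv w) \<circ> swindle w = id" by (auto simp: swindle_inverse)
  show "swindle w \<circ> swindle (inv w) = id"
    using fundamental_domain_map.swindle_inverse[OF inverse] bij by (auto simp: inv_inv_eq)
qed

lemma swindle_strict_mono: "strict_mono (swindle w)"
proof (rule strict_monoI)
  show "swindle w x < swindle w y" if "x < y" for x y using that
  proof (induction x arbitrary: y rule: doubling_induct)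
    case (1 x)
    consider "0 < x" "y < 1 / 4" | "0 < x" "x < 1 / 4" "1 / 4 \<le> y" | "x \<le> 0" "0 < y" "y < 1 / 4"
      | "x \<le> 0 \<or> 1 / 4 \<le> x" "y \<le> 0 \<or> 1 / 4 \<le> y" using 1(2) by linarith
    then show ?case
    proof cases
      case 1
      then show ?thesis using "1.IH"[of "2 * y"] "1.prems" swindle_small[of x w] swindle_small[of y w] by auto
    next
      case 2
      have "w (1 / 4) \<le> w y" using 2 mono by (simp add: strict_mono_less_eq)
      then have "1 / 4 \<le> w y" using out[of "1/4"] by simp
      then show ?thesis using 2 swindle_range_quarter[of x] swindle_large[of y w] by auto
    next
      case 3
      then show ?thesis using swindle_range_quarter[of y] out[of x] swindle_large[of x w] by auto
    next
      case 4
      then show ?thesis using mono "1.prems" swindle_large[of x w] swindle_large[of y w] by (simp add: strict_mono_less)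
    qed
  qed
qed

lemma swindle_fixes: "x \<le> 0 \<or> 1 / 2 \<le> x \<Longrightarrow> swindle w x = x"
  using out[of x] swindle_large[of x w] by auto

text \<open>An increasing bijection of the line is continuous, so the infinitely many junctions 1/4,
  1/8, ... produce no break points.\<close>

lemma swindle_G: "swindle w \<in> cts.G"
proof (rule cts.G_I[where T = "{}"])
  show "perm_X (swindle w)"
    using swindle_bij swindle_fixes by (auto simp: perm_X_iff Xint_def)
  have "continuous_on UNIV (swindle w)"
    using swindle_bij swindle_strict_mono
    by (intro continuous_onI_mono) (auto simp: bij_is_surj strict_mono_less_eq)
  then show "isCont (swindle w) x" for x by (simp add: continuous_on_eq_continuous_at)
qed simp

text \<open>Conjugation by \<open>t\<close> shifts the infinite product by one factor and loses
  exactly the first one, \<open>w\<close>. The equation \<open>eq\<close> in the proof states this: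
  on \<open>]0, 1/2[\<close> both sides are \<open>swindle w x / 2\<close>, and elsewhere
  \<open>swindle w\<close> fixes \<open>x\<close> and acts as \<open>w\<close> at
  \<open>t x\<close>.\<close>

lemma commutator_swindle:
  fixes t :: "real \<Rightarrow> real"
  defines "t \<equiv> two_piece 1 (1 / 2) (1 / 4)"
  shows "(swindle w \<circ> t \<circ> inv (swindle w)) \<circ> inv t = w"
proof -
  have bt: "bij t" unfolding t_def by (intro two_piece_bij) auto
  have t_left: "t x = x / 2" if "0 < x" "x \<le> 1 / 2" for x
    using that unfolding t_def by (subst two_piece_left) auto
  have t_right: "1 / 4 \<le> t x" if le: "1 / 2 \<le> x" for x
  proof -
    consider "x = 1 / 2" | "1 / 2 < x" "x < 1" | "1 \<le> x" using le by linarith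
    then show ?thesis
    proof cases
      case 1
      then show ?thesis using t_left[of x] by simp
    next
      case 2
      then show ?thesis unfolding t_def by (subst two_piece_right) auto
    next
      case 3
      then show ?thesis by (simp add: t_def two_piece_outside)
    qed
  qed
  have eq: "swindle w (t x) = w (t (swindle w x))" for x
  proof (cases "0 < x \<and> x < 1 / 2")
    case True
    have W: "0 < swindle w x" "swindle w x < 1 / 2" using swindle_range_half[of x] True by auto
    have "swindle w (t x) = swindle w x / 2" using True swindle_small[of "x / 2"] by (simp add: t_left)
    moreover have "w (t (swindle w x)) = swindle w x / 2" using W out by (simp add: t_left)
    ultimately show ?thesis by simp
  next
    case False
    then have "t x \<le> 0 \<or> 1 / 4 \<le> t x"
      using t_right[of x] by (cases "x \<le> 0") (auto simp: t_def two_piece_outside)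
    then show ?thesis using False swindle_fixes[of x] swindle_large[of "t x" w] by auto
  qed
  show ?thesis
  proof
    fix y
    have "swindle w (inv (swindle w) (inv t y)) = inv t y"
      using swindle_bij by (simp add: bij_is_surj surj_f_inv_f)
    then show "((swindle w \<circ> t \<circ> inv (swindle w)) \<circ> inv t) y = w y"
      using bt by (simp add: eq bij_is_surj surj_f_inv_f)
  qed
qed

end

lemma noncentral_normal_PC:
  assumes "noncentral_normal isCont N" shows "N = cts.G"
proof -
  interpret noncentral_normal isCont N by fact
  have fundamental: "w \<in> N" if "fundamental_domain_map w" for w
  proof -
    interpret fundamental_domain_map w by fact
    have "two_piece 1 (1 / 2) (1 / 4) \<in> N" by (intro two_piece_N) auto
    then show ?thesis
      \<comment> \<open>The halving map lies in \<open>N\<close> as a two-piece map, hence so does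
        its commutator with any element of \<open>G\<close>.\<close>
      using commutator_swindle N_comp N_conj[OF _ swindle_G] N_inv by metis
  qed
  interpret noncentral_normal_base isCont N
  proof
    fix u and a b :: real
    assume uG: "u \<in> cts.G" and ab: "0 \<le> b" "b < a" "a \<le> 1" "a - b < 1"
      and out: "\<And>x. x \<notin> {b<..<a} \<Longrightarrow> u x = x" and mono: "strict_mono_on {b<..<a} u"
    define l where "l = a - b"
    have l: "0 < l" "l < 1" using ab by (auto simp: l_def)
    \<comment> \<open>Carries \<open>]b, a[\<close> affinely onto \<open>]1/4, 1/2[\<close>: flip to
      \<open>]0, l[\<close>, scale to \<open>]0, 1/4[\<close>, flip to \<open>]1/4, 1/2[\<close>.
      The two flips together preserve orientation, and \<open>l < 1\<close> permits the
      scaling.\<close>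
    define k where "k = refl_on_ivl 0 (1 / 2) \<circ> (two_piece 1 l (1 / 4) \<circ> refl_on_ivl 0 a)"
    have kG: "k \<in> cts.G" unfolding k_def using ab l by (intro cts.G_comp cts.refl_G cts.two_piece_G) auto
    have bk: "bij k" by (rule cts.G_bij[OF kG])
    have k: "k x = 1 / 2 - (a - x) / (4 * l)" "1 / 4 < k x" "k x < 1 / 2" if "b < x" "x < a" for x
    proof -
      define z where "z = (a - x) / (4 * l)"
      have "refl_on_ivl 0 a x = a - x" using that ab by (simp add: refl_on_ivl_def)
      moreover have "two_piece 1 l (1 / 4) (a - x) = z"
        using that l unfolding z_def by (subst two_piece_left) (auto simp: l_def)
      moreover have r: "0 < z" "z < 1 / 4" using that l by (auto simp: field_simps l_def z_def)
      moreover have "refl_on_ivl 0 (1 / 2) z = 1 / 2 - z" using r by (simp add: refl_on_ivl_def)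
      ultimately have kz: "k x = 1 / 2 - z" by (simp add: k_def)
      then show "k x = 1 / 2 - (a - x) / (4 * l)" by (simp add: z_def)
      show "1 / 4 < k x" "k x < 1 / 2" using r kz by auto
    qed
    have k_inv: "\<exists>x. b < x \<and> x < a \<and> y = k x" if "1 / 4 < y" "y < 1 / 2" for y
    proof -
      define x where "x = a - (1 / 2 - y) * (4 * l)"
      have "(1 / 2 - y) * (4 * l) < 1 / 4 * (4 * l)" using that l by (intro mult_strict_right_mono) auto
      moreover have "0 < (1 / 2 - y) * (4 * l)" by (rule mult_pos_pos) (use that l in auto)
      ultimately have x: "b < x" "x < a" by (auto simp: x_def l_def)
      moreover have "y = k x" using k(1)[OF x] l by (simp add: x_def)
      ultimately show ?thesis by blast
    qed
    define w where "w = k \<circ> u \<circ> inv k"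
    have wk: "w (k x) = k (u x)" for x using bk by (simp add: w_def bij_is_inj)
    have u_maps: "b < u x" "u x < a" if "b < x" "x < a" for x
      using bij_fixing_complement_maps[of u "{b<..<a}" x] cts.G_bij[OF uG] out that by auto
    have bw: "bij w"
      unfolding w_def using bk cts.G_bij[OF uG] by (intro bij_comp bij_imp_bij_inv)
    have w_out: "w y = y" if "y \<notin> {1/4<..<1/2}" for y
    proof -
      obtain x where x: "y = k x" using bk by (metis bij_pointE)
      then have "x \<notin> {b<..<a}" using that k[of x] by auto
      then show ?thesis using x wk[of x] out[of x] by simp
    qed
    have "strict_mono_on {1/4<..<1/2} w"
    proof (rule strict_mono_onI)
      fix y y' :: real assume y: "y \<in> {1/4<..<1/2}" "y' \<in> {1/4<..<1/2}" "y < y'"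
      obtain x x' where x: "b < x" "x < a" "y = k x" "b < x'" "x' < a" "y' = k x'"
        using k_inv[of y] k_inv[of y'] y by auto
      have "x < x'" using y(3) k(1)[OF x(1,2)] k(1)[OF x(4,5)] x(3,6) l by (simp add: divide_less_cancel)
      then have "u x < u x'" using mono x by (auto simp: strict_mono_on_def)
      then have "k (u x) < k (u x')"
        using k(1)[OF u_maps[OF x(1,2)]] k(1)[OF u_maps[OF x(4,5)]] l by (simp add: divide_less_cancel)
      then show "w y < w y'" using x wk by simp
    qed
    with bw w_out have "strict_mono w" by (rule strict_mono_fixing_complement)
    then have "w \<in> N" using bw w_out by (intro fundamental) (unfold_locales, auto)
    then show "u \<in> N" unfolding w_def by (rule N_unconj[OF _ kG])
  qed
  show ?thesis by (rule N_eq_G)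
qed

subsection \<open>Passage to the quotient\<close>

lemma perm_group_simps [simp]:
  "carrier (perm_group C) = C" "f \<otimes>\<^bsub>perm_group C\<^esub> g = f \<circ> g" "\<one>\<^bsub>perm_group C\<^esub> = id"
  by (simp_all add: perm_group_def)

context local_regularity
begin

lemma id_Sfin: "id \<in> Sfin" by (auto simp: Sfin_def perm_X_iff)

lemma G_group: "group (perm_group G)"
proof (rule groupI)
  show "\<exists>g \<in> carrier (perm_group G). g \<otimes>\<^bsub>perm_group G\<^esub> f = \<one>\<^bsub>perm_group G\<^esub>"
    if "f \<in> carrier (perm_group G)" for f
    using that by (intro bexI[of _ "inv f"]) (auto simp: G_inv G_perm perm_X_inv_f fun_eq_iff)
qed (use id_Sfin Sfin_subset_G in \<open>auto simp: G_comp o_assoc\<close>)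

lemma m_inv_G: assumes "f \<in> G" shows "m_inv (perm_group G) f = inv f"
proof (rule group.inv_equality[OF G_group])
  show "inv f \<otimes>\<^bsub>perm_group G\<^esub> f = \<one>\<^bsub>perm_group G\<^esub>"
    using assms by (auto simp: G_perm perm_X_inv_f)
qed (use assms G_inv in auto)

lemma Sfin_normal: "Sfin \<lhd> perm_group G"
proof -
  interpret group "perm_group G" by (rule G_group)
  have conj: "k \<circ> f \<circ> inv k \<in> Sfin" if k: "k \<in> G" and f: "f \<in> Sfin" for k f
  proof -
    have "{x. (k \<circ> f \<circ> inv k) x \<noteq> x} \<subseteq> k ` {x. f x \<noteq> x}"
    proof
      fix x assume "x \<in> {x. (k \<circ> f \<circ> inv k) x \<noteq> x}"
      then show "x \<in> k ` {x. f x \<noteq> x}"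
        using perm_X_f_inv[OF G_perm[OF k], of x] by (intro image_eqI[of _ _ "inv k x"]) auto
    qed
    then have "finite {x. (k \<circ> f \<circ> inv k) x \<noteq> x}"
      by (rule finite_subset) (use f in \<open>simp add: Sfin_def\<close>)
    then show ?thesis using f G_perm[OF k] by (simp add: Sfin_def perm_X_comp perm_X_inv)
  qed
  have "subgroup Sfin (perm_group G)"
  proof (rule subgroupI)
    show "Sfin \<noteq> {}" using id_Sfin by auto
    show "m_inv (perm_group G) f \<in> Sfin" if f: "f \<in> Sfin" for f
    proof -
      have perm: "perm_X f" using f by (simp add: Sfin_def)
      have "inv f x = x" if "f x = x" for x using perm_X_inv_f[OF perm, of x] that by simp
      then have "{x. inv f x \<noteq> x} \<subseteq> {x. f x \<noteq> x}" by blast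
      then have "finite {x. inv f x \<noteq> x}" by (rule finite_subset) (use f in \<open>simp add: Sfin_def\<close>)
      then have "inv f \<in> Sfin" using perm by (simp add: Sfin_def perm_X_inv)
      then show ?thesis using f Sfin_subset_G by (simp add: m_inv_G subsetD)
    qed
    show "f \<otimes>\<^bsub>perm_group G\<^esub> g \<in> Sfin" if "f \<in> Sfin" "g \<in> Sfin" for f g
    proof -
      have "{x. (f \<circ> g) x \<noteq> x} \<subseteq> {x. f x \<noteq> x} \<union> {x. g x \<noteq> x}" by auto
      then have "finite {x. (f \<circ> g) x \<noteq> x}"
        by (rule finite_subset) (use that in \<open>simp add: Sfin_def\<close>)
      then show ?thesis using that by (simp add: Sfin_def perm_X_comp)
    qed
  qed (use Sfin_subset_G in auto)
  then show ?thesis unfolding normal_inv_iff using conj m_inv_G by simp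
qed

text \<open>Supplies a nontrivial element of the quotient.\<close>

lemma reflection_not_Sfin: "refl_on_ivl 0 1 \<notin> Sfin"
proof
  assume "refl_on_ivl 0 1 \<in> Sfin"
  then have "finite {x. refl_on_ivl 0 1 x \<noteq> x}" by (simp add: Sfin_def)
  moreover have "{0<..<1/2} \<subseteq> {x. refl_on_ivl 0 1 x \<noteq> x}" by (auto simp: refl_on_ivl_def)
  ultimately have "finite {0<..<1/2::real}" using finite_subset by blast
  then show False using infinite_Ioo[of 0 "1/2::real"] by simp
qed

text \<open>Correspondence of normal subgroups: the preimage \<open>N\<close> of \<open>H\<close>
  contains \<open>Sfin\<close>. If they are equal, \<open>H\<close> is trivial; otherwise the
  hypothesis gives \<open>N = G\<close>, and \<open>H\<close> is everything because the projection
  is surjective.\<close>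

lemma simple_quotient:
  assumes simple: "\<And>N. noncentral_normal P N \<Longrightarrow> N = G"
  shows "simple_grp (perm_group G Mod Sfin)"
proof -
  let ?G = "perm_group G" and ?Q = "perm_group G Mod Sfin"
  interpret normal Sfin ?G by (rule Sfin_normal)
  define \<pi> where "\<pi> f = Sfin #>\<^bsub>?G\<^esub> f" for f
  interpret \<pi>: group_hom ?G ?Q \<pi>
  proof -
    have "\<pi> \<in> hom ?G ?Q" unfolding \<pi>_def by (rule r_coset_hom_Mod)
    then show "group_hom ?G ?Q \<pi>"
      using G_group factorgroup_is_group by (simp add: group_hom_def group_hom_axioms_def)
  qed
  have Q: "\<exists>f \<in> G. X = \<pi> f" if "X \<in> carrier ?Q" for X
    using that by (auto simp: FactGroup_def RCOSETS_def \<pi>_def)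
  have one: "\<one>\<^bsub>?Q\<^esub> = Sfin" by (simp add: FactGroup_def)
  have \<pi>_one: "\<pi> f = Sfin \<longleftrightarrow> f \<in> Sfin" if "f \<in> G" for f
    using that rcos_self[of f] subgroup_axioms coset_join2[of f Sfin] by (auto simp: \<pi>_def)
  show ?thesis
    unfolding simple_grp_def
  proof (intro conjI allI impI)
    show "group ?Q" by (rule factorgroup_is_group)
    have "refl_on_ivl 0 1 \<in> G" by (rule refl_G) auto
    then show "carrier ?Q \<noteq> {\<one>\<^bsub>?Q\<^esub>}"
      using reflection_not_Sfin \<pi>_one \<pi>.hom_closed one by (metis perm_group_simps(1) singletonD)
    fix H assume "H \<lhd> ?Q"
    then interpret H: normal H ?Q .
    define N where "N = {f \<in> G. \<pi> f \<in> H}"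
    show "H = {\<one>\<^bsub>?Q\<^esub>} \<or> H = carrier ?Q"
    proof (cases "N = Sfin")
      case True
      have "X = \<one>\<^bsub>?Q\<^esub>" if X: "X \<in> H" for X
      proof -
        obtain f where "f \<in> G" "X = \<pi> f" using Q H.subset X by blast
        then show ?thesis using X True \<pi>_one one by (auto simp: N_def)
      qed
      then show ?thesis using H.one_closed by blast
    next
      case False
      have "noncentral_normal P N"
      proof
        show "N \<subseteq> G" by (auto simp: N_def)
        show "Sfin \<subseteq> N"
        proof
          fix f assume f: "f \<in> Sfin"
          then have "f \<in> G" using Sfin_subset_G by blast
          moreover have "\<pi> f = \<one>\<^bsub>?Q\<^esub>" using \<pi>_one[OF \<open>f \<in> G\<close>] f one by simp
          ultimately show "f \<in> N" using H.one_closed by (simp add: N_def)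
        qed
        show "f \<circ> g \<in> N" if "f \<in> N" "g \<in> N" for f g
          using that \<pi>.hom_mult[of f g] H.m_closed by (auto simp: N_def G_comp)
        show "inv f \<in> N" if "f \<in> N" for f
          using that \<pi>.hom_inv[of f] H.m_inv_closed by (auto simp: N_def G_inv m_inv_G)
        show "k \<circ> f \<circ> inv k \<in> N" if "f \<in> N" "k \<in> G" for f k
        proof -
          have "\<pi> (k \<circ> f \<circ> inv k) = \<pi> k \<otimes>\<^bsub>?Q\<^esub> \<pi> f \<otimes>\<^bsub>?Q\<^esub> m_inv ?Q (\<pi> k)"
            using that \<pi>.hom_mult[of "k \<circ> f" "inv k"] \<pi>.hom_mult[of k f] \<pi>.hom_inv[of k]
            by (auto simp: N_def G_inv m_inv_G G_comp)
          also have "\<dots> \<in> H" using that \<pi>.hom_closed[of k] by (intro H.inv_op_closed2) (auto simp: N_def)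
          finally show ?thesis using that by (auto simp: N_def intro!: G_comp G_inv)
        qed
        show "N \<noteq> Sfin" by (rule False)
      qed
      then have "N = G" by (rule simple)
      then have "carrier ?Q \<subseteq> H" using Q by (auto simp: N_def)
      then show ?thesis using H.subset by blast
    qed
  qed
qed

end

theorem theorem1p4:
  shows "simple_grp PC \<and> simple_grp PAff"
  unfolding PC_def PAff_def hatPC_eq hatPAff_eq
  by (intro conjI cts.simple_quotient aff.simple_quotient noncentral_normal_PC noncentral_normal_PAff)

end
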